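(* Let $p$ be a prime, let $G$ be an abelian $p$-group and let $H=\bigoplus_{i=1}^n H_i$ be a finite subgroup of $G$ such that $H\cap p^\omega G=0$ and each $H_i=\langle z_i\rangle$ is a cyclic group of exponent $e_i$. The following are equivalent: (1) $H\in\mathcal{W}(G)$; (2) (a) for all $i,j\in\{1,\dots,n\}$, if $e_j\leq e_i$ then $U(z_i)\leq U(z_j)\leq U(p^{e_i-e_j}z_i)$, and (b) $H=\bigoplus_{i=1}^n H_i$ is a valuated direct sum of cyclic groups.
   Context: All groups are abelian; $p$ is a fixed prime. $\mathcal{W}(G)$ is the set of subgroups $N\le G$ such that every endomorphism of $N$ extends to an endomorphism of $G$. $p^\omega G=\bigcap_{n>0}p^nG$. A cyclic group of exponent $e$ is one of order $p^e$. For $x\in G$, $h(x)$ denotes the (generalized, ordinal-valued) $p$-height of $x$ in $G$: $h(x)=\sigma$ if $x\in p^\sigma G\setminus p^{\sigma+1}G$, and $h(x)=\infty$ if $x$ lies in the divisible part of $G$. If $x$ has order $p^m$, its Ulm sequence is $U(x)=(h(x),h(px),\dots,h(p^{m-1}x),\infty,\infty,\dots)$; Ulm sequences are compared pointwise, with every ordinal less than $\infty$. A subgroup $H\le G$ carries the valuation $v(x)=h(x)$ induced by heights in $G$, and $H=\bigoplus_{i=1}^n H_i$ is a valuated direct sum if $v(x_1+\dots+x_n)=\min_i v(x_i)$ for all $x_i\in H_i$. *)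

theory Defs
  imports "HOL-Algebra.Multiplicative_Group" "HOL-Computational_Algebra.Primes" "HOL-Library.Extended"
begin

text \<open>
  Abelian groups are written multiplicatively, following HOL-Algebra: \<open>x [^] k\<close> stands for \<open>k x\<close>,
  and \<open>\<one>\<close> for \<open>0\<close>.
\<close>

section \<open>Ordinals\<close>

text \<open>
  The type \<open>'a ordinal\<close> is the initial ordinal of the least cardinal greater than the cardinality
  of \<open>'a\<close>. A strictly decreasing transfinite chain of subgroups of a group with elements in \<open>'a\<close> is
  shorter than that, so every ordinal-valued height of an element of such a group lives in this type
  (this is \<open>ex1_height\<close> below).
\<close>

typedef 'a ordinal = "Field (cardSuc (card_of (UNIV :: 'a set)))"
proof -
  have "Field (cardSuc (card_of (UNIV :: 'a set))) \<noteq> {}"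
    by (rule Field_cardSuc_not_empty[OF card_of_Card_order])
  then show ?thesis by blast
qed

lemma Well_order_cardSuc: "Well_order (cardSuc (card_of A))"
  using cardSuc_Card_order[OF card_of_Card_order, of A] by (simp add: card_order_on_def)

instantiation ordinal :: (type) wellorder
begin

definition less_eq_ordinal :: "'a ordinal \<Rightarrow> 'a ordinal \<Rightarrow> bool" where
  "\<sigma> \<le> \<tau> \<longleftrightarrow> (Rep_ordinal \<sigma>, Rep_ordinal \<tau>) \<in> cardSuc (card_of (UNIV :: 'a set))"

definition less_ordinal :: "'a ordinal \<Rightarrow> 'a ordinal \<Rightarrow> bool" where
  "(\<sigma> :: 'a ordinal) < \<tau> \<longleftrightarrow> \<sigma> \<le> \<tau> \<and> \<sigma> \<noteq> \<tau>"

instance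
proof
  let ?r = "cardSuc (card_of (UNIV :: 'a set))"
  have wo: "Well_order ?r" by (rule Well_order_cardSuc)
  then have lin: "Linear_order ?r" and wf: "wf (?r - Id)"
    by (auto simp: well_order_on_def)
  then have refl: "Refl ?r" and trans: "trans ?r" and antisym: "antisym ?r" and tot: "Total ?r"
    by (auto simp: linear_order_on_def partial_order_on_def preorder_on_def)
  fix x y z :: "'a ordinal"
  have xx: "x \<le> x" for x :: "'a ordinal"
    using refl Rep_ordinal[of x] by (auto simp: less_eq_ordinal_def refl_on_def)
  show "x \<le> x" by (rule xx)
  show as: "x \<le> y \<Longrightarrow> y \<le> x \<Longrightarrow> x = y" for x y :: "'a ordinal"
    using antisym by (auto simp: less_eq_ordinal_def Rep_ordinal_inject dest: antisymD)
  show "x < y \<longleftrightarrow> x \<le> y \<and> \<not> y \<le> x"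
    using as xx by (auto simp: less_ordinal_def)
  show "x \<le> y \<Longrightarrow> y \<le> z \<Longrightarrow> x \<le> z"
    using trans by (auto simp: less_eq_ordinal_def dest: transD)
  show "x \<le> y \<or> y \<le> x"
    using tot xx Rep_ordinal[of x] Rep_ordinal[of y]
    by (cases "x = y") (auto simp: less_eq_ordinal_def total_on_def Rep_ordinal_inject)
next
  let ?r = "cardSuc (card_of (UNIV :: 'a set))"
  fix P :: "'a ordinal \<Rightarrow> bool" and a
  assume step: "\<And>x. (\<And>y. y < x \<Longrightarrow> P y) \<Longrightarrow> P x"
  have "wf (?r - Id)"
    using Well_order_cardSuc by (auto simp: well_order_on_def)
  then have "wf (inv_image (?r - Id) Rep_ordinal)" by (rule wf_inv_image)
  then show "P a"
  proof (induction a rule: wf_induct_rule)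
    case (less x)
    show ?case
      by (rule step, rule less)
        (auto simp: less_ordinal_def less_eq_ordinal_def Rep_ordinal_inject)
  qed
qed

end

lemma no_inj_ordinal: "\<not> inj (f :: 'a ordinal \<Rightarrow> 'a)"
proof
  assume "inj f"
  let ?r = "cardSuc (card_of (UNIV :: 'a set))"
  have "inj_on (f \<circ> Abs_ordinal) (Field ?r)"
    using \<open>inj f\<close> Abs_ordinal_inject by (intro comp_inj_on inj_onI) (auto dest: injD)
  then have "ordLeq3 (card_of (Field ?r)) (card_of (UNIV :: 'a set))"
    using card_of_ordLeq[of "Field ?r" "UNIV :: 'a set"] by blast
  moreover have "ordIso2 (card_of (Field ?r)) ?r"
    by (rule card_of_Field_ordIso[OF cardSuc_Card_order[OF card_of_Card_order]])
  moreover have "ordLess2 (card_of (UNIV :: 'a set)) ?r"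
    by (rule cardSuc_greater[OF card_of_Card_order])
  ultimately show False
    by (meson not_ordLess_ordIso ordIso_symmetric ordLeq_ordLess_trans ordLess_ordIso_trans)
qed

section \<open>Heights\<close>

text \<open>
  \<open>p\<^sup>\<sigma> G\<close> for an ordinal \<open>\<sigma>\<close>. One clause covers the three cases of the usual recursion, see
  \<open>p_power_zero\<close>, \<open>p_power_succ\<close> and \<open>p_power_limit\<close>.
\<close>

function p_power :: "nat \<Rightarrow> ('a, 'b) monoid_scheme \<Rightarrow> 'o::wellorder \<Rightarrow> 'a set" where
  "p_power p G \<sigma> =
     carrier G \<inter> (\<Inter>\<tau>\<in>{\<tau>. \<tau> < \<sigma>}. (\<lambda>x. x [^]\<^bsub>G\<^esub> p) ` p_power p G \<tau>)"
  by auto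
termination
  by (relation "inv_image {(\<tau>, \<sigma>). \<tau> < \<sigma>} (\<lambda>(p, G, \<sigma>). \<sigma>)") (auto simp: wf)

declare p_power.simps [simp del]

definition p_omega :: "nat \<Rightarrow> ('a, 'b) monoid_scheme \<Rightarrow> 'a set" where
  "p_omega p G = (\<Inter>n\<in>{n::nat. n > 0}. (\<lambda>x. x [^]\<^bsub>G\<^esub> (p ^ n)) ` carrier G)"

definition divisible_subgroup :: "'a set \<Rightarrow> ('a, 'b) monoid_scheme \<Rightarrow> bool" where
  "divisible_subgroup D G \<longleftrightarrow>
     subgroup D G \<and> (\<forall>n::nat. n > 0 \<longrightarrow> (\<forall>x\<in>D. \<exists>y\<in>D. y [^]\<^bsub>G\<^esub> n = x))"

text \<open>
  In an abelian group the sum of two divisible subgroups is divisible, so the union of all of them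
  is the largest divisible subgroup.
\<close>

definition divisible_part :: "('a, 'b) monoid_scheme \<Rightarrow> 'a set" where
  "divisible_part G = \<Union>{D. divisible_subgroup D G}"

text \<open>The element \<open>Pinf\<close> of \<open>'a ordinal extended\<close> is \<open>\<infinity>\<close>; its other new element \<open>Minf\<close> is never used.\<close>

definition height :: "nat \<Rightarrow> ('a, 'b) monoid_scheme \<Rightarrow> 'a \<Rightarrow> 'a ordinal extended" where
  "height p G x =
     (if x \<in> divisible_part G then Pinf
      else Fin (THE \<sigma>. x \<in> p_power p G \<sigma> \<and> x \<notin> (\<lambda>y. y [^]\<^bsub>G\<^esub> p) ` p_power p G \<sigma>))"

text \<open>\<open>p ^ k < ord x\<close> says \<open>k < m\<close> when \<open>x\<close> has order \<open>p ^ m\<close>.\<close>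

definition ulm_sequence :: "nat \<Rightarrow> ('a, 'b) monoid_scheme \<Rightarrow> 'a \<Rightarrow> nat \<Rightarrow> 'a ordinal extended" where
  "ulm_sequence p G x =
     (\<lambda>k. if p ^ k < group.ord G x then height p G (x [^]\<^bsub>G\<^esub> (p ^ k)) else Pinf)"

definition p_group :: "nat \<Rightarrow> ('a, 'b) monoid_scheme \<Rightarrow> bool" where
  "p_group p G \<longleftrightarrow> (\<forall>x\<in>carrier G. \<exists>m. group.ord G x = p ^ m)"

definition extending_subgroups :: "('a, 'b) monoid_scheme \<Rightarrow> 'a set set" (\<open>\<W>\<close>) where
  "\<W> G = {N. subgroup N G \<and>
      (\<forall>f \<in> hom (G\<lparr>carrier := N\<rparr>) (G\<lparr>carrier := N\<rparr>). \<exists>g \<in> hom G G. \<forall>x\<in>N. g x = f x)}"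

section \<open>Direct sums\<close>

definition internal_direct_sum ::
    "('a, 'b) monoid_scheme \<Rightarrow> 'a set \<Rightarrow> 'i set \<Rightarrow> ('i \<Rightarrow> 'a set) \<Rightarrow> bool" where
  "internal_direct_sum G H I K \<longleftrightarrow>
     subgroup H G \<and> (\<forall>i\<in>I. subgroup (K i) G) \<and>
     bij_betw (\<lambda>x. finprod G x I) (\<Pi>\<^sub>E i\<in>I. K i) H"

text \<open>The inserted \<open>Pinf\<close> only matters for \<open>I = {}\<close>, where it makes the minimum \<open>\<infinity>\<close>.\<close>

definition valuated_direct_sum ::
    "nat \<Rightarrow> ('a, 'b) monoid_scheme \<Rightarrow> 'a set \<Rightarrow> 'i set \<Rightarrow> ('i \<Rightarrow> 'a set) \<Rightarrow> bool" where
  "valuated_direct_sum p G H I K \<longleftrightarrow>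
     internal_direct_sum G H I K \<and>
     (\<forall>x \<in> \<Pi>\<^sub>E i\<in>I. K i.
        height p G (finprod G x I) = Min (insert Pinf ((\<lambda>i. height p G (x i)) ` I)))"

section \<open>Adequacy of the encoding of heights\<close>

lemma p_power_iff:
  "x \<in> p_power p G \<sigma> \<longleftrightarrow>
     x \<in> carrier G \<and> (\<forall>\<tau><\<sigma>. x \<in> (\<lambda>y. y [^]\<^bsub>G\<^esub> p) ` p_power p G \<tau>)"
  by (subst p_power.simps) (simp only: Int_iff INT_iff Ball_def mem_Collect_eq)

lemma p_power_zero: "(\<And>\<tau>. \<not> \<tau> < \<sigma>) \<Longrightarrow> p_power p G \<sigma> = carrier G"
  by (rule Set.set_eqI) (simp add: p_power_iff[of _ p G \<sigma>])

lemma p_power_antimono: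
  assumes "\<sigma> \<le> \<tau>" shows "p_power p G \<tau> \<subseteq> p_power p G \<sigma>"
proof
  fix x assume "x \<in> p_power p G \<tau>"
  then have "x \<in> carrier G" "\<forall>\<rho><\<tau>. x \<in> (\<lambda>y. y [^]\<^bsub>G\<^esub> p) ` p_power p G \<rho>"
    using p_power_iff by metis+
  with assms have "\<forall>\<rho><\<sigma>. x \<in> (\<lambda>y. y [^]\<^bsub>G\<^esub> p) ` p_power p G \<rho>"
    by (meson less_le_trans)
  with \<open>x \<in> carrier G\<close> show "x \<in> p_power p G \<sigma>" by (subst p_power_iff) (rule conjI)
qed

lemma p_power_subset: "p_power p G \<sigma> \<subseteq> carrier G"
  by (rule subsetI, subst (asm) p_power_iff) (rule conjunct1)

lemma p_power_succ:
  assumes "group G" and succ: "\<And>\<tau>. \<tau> < \<sigma>' \<longleftrightarrow> \<tau> \<le> \<sigma>"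
  shows "p_power p G \<sigma>' = (\<lambda>x. x [^]\<^bsub>G\<^esub> p) ` p_power p G \<sigma>"
proof (intro equalityI subsetI)
  fix x assume "x \<in> p_power p G \<sigma>'"
  then show "x \<in> (\<lambda>x. x [^]\<^bsub>G\<^esub> p) ` p_power p G \<sigma>"
    by (subst (asm) p_power_iff) (simp only: succ order_refl)
next
  interpret group G by fact
  fix x assume x: "x \<in> (\<lambda>x. x [^]\<^bsub>G\<^esub> p) ` p_power p G \<sigma>"
  then have "x \<in> carrier G"
    using p_power_subset[of p G \<sigma>] nat_pow_closed by auto
  moreover have "x \<in> (\<lambda>x. x [^]\<^bsub>G\<^esub> p) ` p_power p G \<tau>" if "\<tau> < \<sigma>'" for \<tau>
  proof -
    have "\<tau> \<le> \<sigma>" using that by (simp only: succ)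
    then show ?thesis by (rule subsetD[OF image_mono[OF p_power_antimono] x])
  qed
  ultimately show "x \<in> p_power p G \<sigma>'" by (subst p_power_iff) blast
qed

lemma p_power_limit:
  assumes ex: "\<exists>\<tau>. \<tau> < \<sigma>" and lim: "\<And>\<tau>. \<tau> < \<sigma> \<Longrightarrow> \<exists>\<rho>>\<tau>. \<rho> < \<sigma>"
  shows "p_power p G \<sigma> = (\<Inter>\<tau>\<in>{\<tau>. \<tau> < \<sigma>}. p_power p G \<tau>)"
proof (intro equalityI subsetI INT_I)
  fix x \<tau> assume "x \<in> p_power p G \<sigma>" "\<tau> \<in> {\<tau>. \<tau> < \<sigma>}"
  then show "x \<in> p_power p G \<tau>"
    using subsetD[OF p_power_antimono[of \<tau> \<sigma> p G]] by simp
next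
  fix x assume x: "x \<in> (\<Inter>\<tau>\<in>{\<tau>. \<tau> < \<sigma>}. p_power p G \<tau>)"
  have "x \<in> (\<lambda>x. x [^]\<^bsub>G\<^esub> p) ` p_power p G \<tau>" if t: "\<tau> < \<sigma>" for \<tau>
  proof -
    obtain \<rho> where "\<tau> < \<rho>" "\<rho> < \<sigma>" using lim[OF t] by blast
    then have "x \<in> p_power p G \<rho>" using x by simp
    then show ?thesis using \<open>\<tau> < \<rho>\<close> by (subst (asm) p_power_iff) simp
  qed
  moreover have "x \<in> carrier G" using x ex p_power_subset[of p G] by blast
  ultimately show "x \<in> p_power p G \<sigma>" by (subst p_power_iff) simp
qed

lemma subgroup_p_power:
  fixes G (structure)
  assumes "comm_group G" shows "subgroup (p_power p G (\<sigma> :: 'o::wellorder)) G"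
proof (induction \<sigma> rule: less_induct)
  case (less \<sigma>)
  interpret comm_group G by fact
  have *: "subgroup ((\<lambda>x. x [^] p) ` p_power p G \<tau>) G" if "\<tau> < \<sigma>" for \<tau>
  proof -
    interpret S: subgroup "p_power p G \<tau>" G by (rule less.IH[OF that])
    show ?thesis
    proof (rule subgroupI)
      show "(\<lambda>x. x [^] p) ` p_power p G \<tau> \<subseteq> carrier G" by auto
      show "(\<lambda>x. x [^] p) ` p_power p G \<tau> \<noteq> {}" using S.one_closed by blast
    next
      fix a assume "a \<in> (\<lambda>x. x [^] p) ` p_power p G \<tau>"
      then obtain x where "x \<in> p_power p G \<tau>" "a = x [^] p" by blast
      then show "inv a \<in> (\<lambda>x. x [^] p) ` p_power p G \<tau>"
        by (auto intro!: image_eqI[where x = "inv x"] simp: nat_pow_inv)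
    next
      fix a b assume "a \<in> (\<lambda>x. x [^] p) ` p_power p G \<tau>" "b \<in> (\<lambda>x. x [^] p) ` p_power p G \<tau>"
      then obtain x y where "x \<in> p_power p G \<tau>" "a = x [^] p" "y \<in> p_power p G \<tau>" "b = y [^] p"
        by blast
      then show "a \<otimes> b \<in> (\<lambda>x. x [^] p) ` p_power p G \<tau>"
        by (auto intro!: image_eqI[where x = "x \<otimes> y"] simp: nat_pow_distrib)
    qed
  qed
  show ?case
  proof (rule subgroup.intro)
    show "p_power p G \<sigma> \<subseteq> carrier G" by (rule p_power_subset)
    show "\<one> \<in> p_power p G \<sigma>"
      unfolding p_power_iff[of _ p G \<sigma>] using subgroup.one_closed[OF *] by blast
    show "inv x \<in> p_power p G \<sigma>" if "x \<in> p_power p G \<sigma>" for x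
      using that subgroup.m_inv_closed[OF *] inv_closed unfolding p_power_iff[of _ p G \<sigma>] by metis
    show "x \<otimes> y \<in> p_power p G \<sigma>" if "x \<in> p_power p G \<sigma>" "y \<in> p_power p G \<sigma>" for x y
      using that subgroup.m_closed[OF *] m_closed unfolding p_power_iff[of _ p G \<sigma>] by metis
  qed
qed

lemma divisible_subgroupI_p_group:
  fixes G (structure)
  assumes "comm_group G" "prime p" "p_group p G" "subgroup D G"
    and D: "D \<subseteq> (\<lambda>x. x [^]\<^bsub>G\<^esub> p) ` D"
  shows "divisible_subgroup D G"
  unfolding divisible_subgroup_def
proof (intro conjI allI impI ballI)
  interpret comm_group G by fact
  interpret S: subgroup D G by fact
  fix n :: nat and x assume "n > 0" "x \<in> D"
  then show "\<exists>y\<in>D. y [^]\<^bsub>G\<^esub> n = x"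
  proof (induction n arbitrary: x rule: less_induct)
    case (less n)
    show ?case
    proof (cases "p dvd n")
      case True
      then obtain k where k: "n = p * k" by blast
      have "0 < k" using k less.prems(1) by simp
      have "k < n" using k \<open>0 < k\<close> prime_gt_1_nat[OF assms(2)] by simp
      obtain w where "w \<in> D" "w [^] p = x" using D less.prems by blast
      obtain y where "y \<in> D" "y [^] k = w"
        using less.IH[OF \<open>k < n\<close> \<open>0 < k\<close> \<open>w \<in> D\<close>] by blast
      have "y [^] n = (y [^] k) [^] p"
        using \<open>y \<in> D\<close> k by (simp add: nat_pow_pow mult.commute)
      then show ?thesis using \<open>w [^] p = x\<close> \<open>y [^] k = w\<close> by (intro bexI[OF _ \<open>y \<in> D\<close>]) simp
    next
      case False
      have xG: "x \<in> carrier G" using less.prems by auto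
      then obtain m where m: "ord x = p ^ m" using assms(3) by (auto simp: p_group_def)
      have "coprime n (p ^ m)"
        using False assms(2) by (metis coprime_commute coprime_power_right_iff prime_imp_coprime)
      then have gcd: "gcd n (p ^ m) = 1" by (simp only: coprime_iff_gcd_eq_1)
      have "n \<noteq> 0" using less.prems(1) by simp
      from bezout_nat[OF this, of "p ^ m"] obtain a b where "n * a = p ^ m * b + 1"
        unfolding gcd by blast
      then have ab: "a * n = Suc (p ^ m * b)" by (simp only: mult.commute[of a] Suc_eq_plus1)
      have "x [^] (p ^ m) = \<one>" using pow_ord_eq_1[OF xG] m by simp
      moreover have "x [^] (p ^ m * b) = (x [^] (p ^ m)) [^] b"
        using xG by (simp only: nat_pow_pow)
      ultimately have pm: "x [^] (p ^ m * b) = \<one>" by (simp only: nat_pow_one)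
      have "(x [^] a) [^] n = x [^] Suc (p ^ m * b)"
        using xG by (simp only: nat_pow_pow ab)
      also have "\<dots> = x" using xG by (simp add: pm)
      finally have xan: "(x [^] a) [^] n = x" .
      have "x [^] a \<in> D"
        using less.prems(2) by (induction a) auto
      with xan show ?thesis by (rule bexI)
    qed
  qed
qed fact

lemma ex1_height:
  fixes G :: "('a, 'b) monoid_scheme" (structure)
  assumes "comm_group G" "prime p" "p_group p G" and x: "x \<in> carrier G" "x \<notin> divisible_part G"
  shows "\<exists>!\<sigma> :: 'a ordinal. x \<in> p_power p G \<sigma> \<and> x \<notin> (\<lambda>y. y [^]\<^bsub>G\<^esub> p) ` p_power p G \<sigma>"
proof (rule ex_ex1I)
  interpret comm_group G by fact
  show "\<exists>\<sigma> :: 'a ordinal. x \<in> p_power p G \<sigma> \<and> x \<notin> (\<lambda>y. y [^]\<^bsub>G\<^esub> p) ` p_power p G \<sigma>"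
  proof (rule ccontr)
    assume neg: "\<not> ?thesis"
    have xs: "x \<in> p_power p G \<sigma>" for \<sigma> :: "'a ordinal"
    proof (induction \<sigma> rule: less_induct)
      case (less \<sigma>)
      then show ?case using neg x(1) by (subst p_power_iff) blast
    qed
    have "\<exists>y. y \<in> p_power p G \<sigma> \<and> y \<notin> (\<lambda>y. y [^] p) ` p_power p G \<sigma>" for \<sigma> :: "'a ordinal"
    proof (rule ccontr)
      assume "\<not> ?thesis"
      then have "divisible_subgroup (p_power p G \<sigma>) G"
        using divisible_subgroupI_p_group[OF assms(1-3) subgroup_p_power[OF assms(1)]] by blast
      then show False using x(2) xs by (auto simp: divisible_part_def)
    qed
    then obtain f where f: "\<And>\<sigma> :: 'a ordinal. f \<sigma> \<in> p_power p G \<sigma>"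
        "\<And>\<sigma> :: 'a ordinal. f \<sigma> \<notin> (\<lambda>y. y [^] p) ` p_power p G \<sigma>"
      by metis
    have ne: "f \<sigma> \<noteq> f \<tau>" if "\<sigma> < \<tau>" for \<sigma> \<tau>
      using f(1)[of \<tau>] f(2)[of \<sigma>] that unfolding p_power_iff[of _ p G \<tau>] by metis
    have "inj f"
      by (rule injI) (metis ne neq_iff)
    then show False using no_inj_ordinal by blast
  qed
next
  fix \<sigma> \<tau> :: "'a ordinal"
  assume *: "x \<in> p_power p G \<sigma> \<and> x \<notin> (\<lambda>y. y [^]\<^bsub>G\<^esub> p) ` p_power p G \<sigma>"
    "x \<in> p_power p G \<tau> \<and> x \<notin> (\<lambda>y. y [^]\<^bsub>G\<^esub> p) ` p_power p G \<tau>"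
  have False if "\<sigma> < \<tau>" "x \<in> p_power p G \<tau>" "x \<notin> (\<lambda>y. y [^]\<^bsub>G\<^esub> p) ` p_power p G \<sigma>"
    for \<sigma> \<tau> :: "'a ordinal"
    using that by (subst (asm) (1) p_power_iff) simp
  with * show "\<sigma> = \<tau>" by (meson neq_iff)
qed

end

theory Submission
  imports Defs
begin

text \<open>
  Everything turns on one fact: an endomorphism of \<open>H\<close> extends to \<open>G\<close> if and only if it is
  height-increasing, that is, never decreases heights computed in \<open>G\<close>.

  One half is immediate, because endomorphisms of \<open>G\<close> do not decrease heights
  (\<open>height_le_hom\<close>). So if every endomorphism of \<open>H\<close> extends, then it is enough to exhibit
  endomorphisms of \<open>H\<close>. Sending \<open>z\<^sub>i\<close> to an element \<open>b\<close> of \<open>H\<close> that is killed by the order of \<open>z\<^sub>i\<close>,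
  and the other generators to \<open>0\<close>, gives \<open>U(z\<^sub>i) \<le> U(b)\<close>; for \<open>b = z\<^sub>j\<close> with \<open>e\<^sub>j \<le> e\<^sub>i\<close>, and with \<open>i\<close> and \<open>j\<close>
  exchanged for \<open>b = p\<^bsup>e\<^sub>i - e\<^sub>j\<^esup> z\<^sub>i\<close>, these are the two inequalities between Ulm sequences. The
  projections onto the summands give \<open>h(x\<^sub>1 + \<dots> + x\<^sub>n) \<le> h(x\<^sub>i)\<close>, which is the half of the valuation
  equation that does not hold for every direct sum.

  For the other implication, the valuation equation and the inequalities between Ulm sequences make
  every endomorphism \<open>f\<close> of \<open>H\<close> height-increasing (\<open>hom_preserves_power_image\<close>). The
  valuation equation reduces this to elements \<open>m z\<^sub>i\<close>. The component of \<open>f(z\<^sub>i)\<close> in \<open>H\<^sub>j\<close> is killed by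
  \<open>p\<^bsup>e\<^sub>i\<^esup>\<close>, hence it is a multiple of \<open>z\<^sub>j\<close> if \<open>e\<^sub>j \<le> e\<^sub>i\<close> and of \<open>p\<^bsup>e\<^sub>j - e\<^sub>i\<^esup> z\<^sub>j\<close> otherwise, and the
  inequalities say that \<open>U(z\<^sub>i)\<close> is below the Ulm sequence of these two elements.

  It remains to extend a height-increasing homomorphism \<open>f\<close>. Since \<open>H\<close> is finite and meets
  \<open>p\<^sup>\<omega>G\<close> trivially, it meets \<open>p\<^sup>NG\<close> trivially for some \<open>N\<close>, so only heights below \<open>N\<close> matter. Extend
  \<open>f\<close> by \<open>0\<close> on \<open>p\<^sup>NG\<close>, and then element by element (\<open>extend_height_graph\<close>): if \<open>b\<close> lies outside
  the domain, \<open>p b\<close> inside, and \<open>b\<close> has the largest height \<open>k\<close> among all such elements, then the image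
  of \<open>p b\<close> lies in \<open>p\<^bsup>k+1\<^esup>G\<close>, so it is \<open>p c\<close> for some \<open>c\<close> in \<open>p\<^sup>kG\<close>, and \<open>b\<close> can be sent to \<open>c\<close>. The
  maximality of \<open>k\<close> is what keeps the extension height-increasing. Zorn's lemma does the rest
  (\<open>extend_height_increasing_hom\<close>).

  In this implication, ordinals enter only when heights are translated into membership in the
  subgroups \<open>p\<^sup>kG\<close> with \<open>k\<close> finite (\<open>height_le_power_image\<close>), which is all that the extension needs.
\<close>

section \<open>Finite powers\<close>

text \<open>
  The additive \<open>m G\<close>. For \<open>m = p ^ k\<close> this is \<open>p\<^sup>kG\<close> with \<open>k\<close> finite. It is kept apart from the subgroups
  \<open>p_power p G \<sigma>\<close> that define heights, because \<open>'a ordinal\<close> is a finite type when \<open>'a\<close> is, and then it does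
  not contain every \<open>k\<close>.
\<close>

definition power_image :: "('a, 'b) monoid_scheme \<Rightarrow> nat \<Rightarrow> 'a set" where
  "power_image G m = (\<lambda>x. x [^]\<^bsub>G\<^esub> m) ` carrier G"

lemma (in comm_group) subgroup_power_image: "subgroup (power_image G m) G"
proof (rule subgroupI)
  show "power_image G m \<subseteq> carrier G" "power_image G m \<noteq> {}"
    by (auto simp: power_image_def)
  show "inv a \<in> power_image G m" if "a \<in> power_image G m" for a
    using that by (auto simp: power_image_def nat_pow_inv intro!: image_eqI[where x = "inv _"])
  show "a \<otimes> b \<in> power_image G m" if ab: "a \<in> power_image G m" "b \<in> power_image G m" for a b
  proof -
    obtain x y where "x \<in> carrier G" "a = x [^] m" "y \<in> carrier G" "b = y [^] m"
      using ab by (auto simp: power_image_def)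
    then show ?thesis
      unfolding power_image_def
      by (intro image_eqI[where x = "x \<otimes> y"]) (simp_all add: nat_pow_distrib)
  qed
qed

lemma (in group) power_image_antimono:
  assumes "k \<le> l" shows "power_image G (p ^ l) \<subseteq> power_image G (p ^ k)"
proof
  fix x assume "x \<in> power_image G (p ^ l)"
  then obtain w where w: "w \<in> carrier G" "x = w [^] (p ^ l)"
    by (auto simp: power_image_def)
  have "x = (w [^] (p ^ (l - k))) [^] (p ^ k)"
    using w assms by (simp add: nat_pow_pow flip: power_add)
  then show "x \<in> power_image G (p ^ k)"
    using w unfolding power_image_def by blast
qed

lemma (in group) power_image_Suc:
  "power_image G (p ^ Suc k) = (\<lambda>x. x [^] p) ` power_image G (p ^ k)"
  unfolding power_image_def image_image
  by (rule image_cong) (simp_all add: nat_pow_pow mult.commute)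

lemma (in group) pow_coprime_mem_subgroup:
  assumes D: "subgroup D G" and b: "b \<in> carrier G"
    and "b [^] (i::int) \<in> D" "b [^] (j::int) \<in> D" "coprime i j"
  shows "b \<in> D"
proof -
  obtain u v where uv: "u * i + v * j = 1"
    using \<open>coprime i j\<close> bezout_int[of i j] by auto
  have "(b [^] i) [^] u \<otimes> (b [^] j) [^] v = b [^] (u * i + v * j)"
    using b by (simp add: int_pow_pow int_pow_mult mult.commute)
  then have "b = (b [^] i) [^] u \<otimes> (b [^] j) [^] v"
    using b uv by simp
  moreover have "(b [^] i) [^] u \<otimes> (b [^] j) [^] v \<in> D"
    by (rule subgroup.m_closed[OF D]) (rule subgroup_int_pow_closed[OF D] assms)+
  ultimately show ?thesis by simp
qed

section \<open>Graphs of partial homomorphisms that respect heights\<close>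

lemma int_pow_DirProd:
  assumes "group G" "group A" "x \<in> carrier G" "y \<in> carrier A"
  shows "(x, y) [^]\<^bsub>G \<times>\<times> A\<^esub> (m::int) = (x [^]\<^bsub>G\<^esub> m, y [^]\<^bsub>A\<^esub> m)"
proof (rule prod_eqI)
  have P: "group (G \<times>\<times> A)" using assms by (simp add: DirProd_group)
  have "fst \<in> hom (G \<times>\<times> A) G" "snd \<in> hom (G \<times>\<times> A) A"
    by (auto simp: hom_def mult_DirProd')
  then show "fst ((x, y) [^]\<^bsub>G \<times>\<times> A\<^esub> m) = fst (x [^]\<^bsub>G\<^esub> m, y [^]\<^bsub>A\<^esub> m)"
    "snd ((x, y) [^]\<^bsub>G \<times>\<times> A\<^esub> m) = snd (x [^]\<^bsub>G\<^esub> m, y [^]\<^bsub>A\<^esub> m)"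
    using assms P by (simp_all add: hom_int_pow)
qed

lemma comm_group_DirProd:
  assumes "comm_group G" "comm_group A" shows "comm_group (G \<times>\<times> A)"
proof -
  interpret G: comm_group G by fact
  interpret A: comm_group A by fact
  interpret group "G \<times>\<times> A" by (simp add: DirProd_group G.is_group A.is_group)
  show ?thesis
    by (rule group_comm_groupI) (auto simp: G.m_comm A.m_comm)
qed

text \<open>
  Partial homomorphisms from \<open>G\<close> to \<open>A\<close> are represented by their graphs, so that extending one is
  set inclusion and the union of a chain is an upper bound for it. A subgroup of \<open>G \<times>\<times> A\<close> is
  single-valued as soon as it relates the identity only to the identity.
\<close>

definition height_graph ::
    "nat \<Rightarrow> nat \<Rightarrow> ('a, 'b) monoid_scheme \<Rightarrow> ('c, 'd) monoid_scheme \<Rightarrow> ('a \<times> 'c) set \<Rightarrow> bool" where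
  "height_graph p N G A R \<longleftrightarrow>
     subgroup R (G \<times>\<times> A) \<and>
     (\<forall>x y. (x, y) \<in> R \<longrightarrow>
        (x = \<one>\<^bsub>G\<^esub> \<longrightarrow> y = \<one>\<^bsub>A\<^esub>) \<and>
        (\<forall>k\<le>N. x \<in> power_image G (p ^ k) \<longrightarrow> y \<in> power_image A (p ^ k)))"

lemma height_graphD:
  assumes "height_graph p N G A R"
  shows "subgroup R (G \<times>\<times> A)"
    and "(\<one>\<^bsub>G\<^esub>, y) \<in> R \<Longrightarrow> y = \<one>\<^bsub>A\<^esub>"
    and "(x, y) \<in> R \<Longrightarrow> k \<le> N \<Longrightarrow> x \<in> power_image G (p ^ k) \<Longrightarrow> y \<in> power_image A (p ^ k)"
  using assms by (auto simp: height_graph_def)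

lemma subgroup_Domain:
  assumes "group G" "group A" "subgroup R (G \<times>\<times> A)"
  shows "subgroup (Domain R) G"
proof -
  have "fst \<in> hom (G \<times>\<times> A) G" by (auto simp: hom_def mult_DirProd')
  then interpret group_hom "G \<times>\<times> A" G fst
    using assms by (intro group_hom.intro group_hom_axioms.intro DirProd_group)
  show ?thesis
    using subgroup_img_is_subgroup[OF assms(3)] by (simp add: Domain_fst)
qed

text \<open>
  The element to add is chosen with the largest height \<open>k\<close> among all elements outside the domain
  whose \<open>p\<close>-th power is inside. Such heights are below \<open>N\<close> because the domain contains the \<open>p ^ N\<close>-th
  powers. If \<open>b\<close> is this element, an element \<open>x b\<^sup>m\<close> of the new domain with \<open>p\<close> not dividing \<open>m\<close> is
  again a candidate for the choice of \<open>b\<close>. So if it is a \<open>p ^ j\<close>-th power, then \<open>j \<le> k\<close>, hence \<open>b\<close> and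
  with it \<open>x\<close> are \<open>p ^ j\<close>-th powers, and so are their images. If \<open>p\<close> divides \<open>m\<close>, nothing new is related.
\<close>

lemma extend_height_graph:
  assumes "prime p" "comm_group G" "p_group p G" "comm_group A"
    and R: "height_graph p N G A R" and N: "power_image G (p ^ N) \<subseteq> Domain R"
    and b0: "b0 \<in> carrier G" "b0 \<notin> Domain R"
  shows "\<exists>R'. height_graph p N G A R' \<and> R \<subset> R'"
proof -
  interpret G: comm_group G by fact
  interpret A: comm_group A by fact
  interpret P: comm_group "G \<times>\<times> A" using assms(2,4) by (rule comm_group_DirProd)
  note RP = height_graphD(1)[OF R]
  interpret R: subgroup R "G \<times>\<times> A" by (rule RP)
  have Rc: "x \<in> carrier G" "y \<in> carrier A" if "(x, y) \<in> R" for x y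
    using R.mem_carrier[OF that] by auto
  have D: "subgroup (Domain R) G"
    by (rule subgroup_Domain[OF G.is_group A.is_group RP])
  interpret D: subgroup "Domain R" G by (rule D)
  (* the candidates for the new element of the domain, of height at least k *)
  define Q where "Q k b \<longleftrightarrow>
    b \<in> carrier G \<and> b \<notin> Domain R \<and> b [^]\<^bsub>G\<^esub> p \<in> Domain R \<and> b \<in> power_image G (p ^ k)" for k b
  have "\<exists>b. Q 0 b"
  proof -
    obtain m where m: "G.ord b0 = p ^ m" using assms(3) b0 by (auto simp: p_group_def)
    have "b0 [^]\<^bsub>G\<^esub> (p ^ m) \<in> Domain R"
      using G.pow_ord_eq_1[OF b0(1)] m by simp
    moreover have "b0 [^]\<^bsub>G\<^esub> (p ^ 0) \<notin> Domain R" using b0 by simp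
    ultimately obtain l where l: "b0 [^]\<^bsub>G\<^esub> (p ^ l) \<notin> Domain R" "b0 [^]\<^bsub>G\<^esub> (p ^ Suc l) \<in> Domain R"
      using dec_induct[of 0 m "\<lambda>l. b0 [^]\<^bsub>G\<^esub> (p ^ l) \<notin> Domain R"] by blast
    have "(b0 [^]\<^bsub>G\<^esub> (p ^ l)) [^]\<^bsub>G\<^esub> p = b0 [^]\<^bsub>G\<^esub> (p ^ Suc l)"
      using b0 by (simp add: G.nat_pow_pow mult.commute)
    moreover have "power_image G (p ^ 0) = carrier G"
      by (auto simp: power_image_def)
    ultimately have "Q 0 (b0 [^]\<^bsub>G\<^esub> (p ^ l))" using l b0 by (simp add: Q_def)
    then show ?thesis ..
  qed
  moreover have Q_less: "k < N" if "\<exists>b. Q k b" for k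
    using that N G.power_image_antimono[of N k p] by (force simp: Q_def not_less[symmetric])
  ultimately obtain k where ex: "\<exists>b. Q k b" and max: "\<And>j. \<exists>b. Q j b \<Longrightarrow> j \<le> k"
    using Nat.GreatestI_ex_nat[of "\<lambda>k. \<exists>b. Q k b" N]
      Nat.Greatest_le_nat[of "\<lambda>k. \<exists>b. Q k b" _ N] by (metis less_imp_le)
  then obtain b where b: "b \<in> carrier G" "b \<notin> Domain R" "b [^]\<^bsub>G\<^esub> p \<in> Domain R"
      "b \<in> power_image G (p ^ k)"
    by (auto simp: Q_def)
  have "k < N" using Q_less ex by blast
  (* the p-th power of b has height at least k + 1, hence so has d; the image of b is a
     p-th root c of d that has height at least k *)
  obtain d where d: "(b [^]\<^bsub>G\<^esub> p, d) \<in> R" using b by blast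
  have "b [^]\<^bsub>G\<^esub> p \<in> power_image G (p ^ Suc k)"
    using b unfolding G.power_image_Suc by blast
  then have "d \<in> power_image A (p ^ Suc k)"
    using \<open>k < N\<close> by (intro height_graphD(3)[OF R d]) simp_all
  then obtain c where c: "c \<in> power_image A (p ^ k)" "d = c [^]\<^bsub>A\<^esub> p"
    unfolding A.power_image_Suc by blast
  have cA: "c \<in> carrier A" using c(1) by (auto simp: power_image_def)
  define R' where "R' = R <#>\<^bsub>G \<times>\<times> A\<^esub> generate (G \<times>\<times> A) {(b, c)}"
  have R'P: "subgroup R' (G \<times>\<times> A)"
    unfolding R'_def using b cA by (intro P.mult_subgroups RP P.generate_is_subgroup) auto
  have R'_iff: "z \<in> R' \<longleftrightarrow> (\<exists>x y m. (x, y) \<in> R \<and>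
      z = (x \<otimes>\<^bsub>G\<^esub> b [^]\<^bsub>G\<^esub> (m::int), y \<otimes>\<^bsub>A\<^esub> c [^]\<^bsub>A\<^esub> m))" for z
    using b cA unfolding R'_def
    by (force simp: set_mult_def P.generate_pow int_pow_DirProd G.is_group A.is_group)
  have coprime_case: "x \<otimes>\<^bsub>G\<^esub> b [^]\<^bsub>G\<^esub> m \<notin> Domain R"
      "\<And>j. x \<otimes>\<^bsub>G\<^esub> b [^]\<^bsub>G\<^esub> m \<in> power_image G (p ^ j) \<Longrightarrow> j \<le> k"
    if x: "(x, y) \<in> R" and m: "\<not> int p dvd m" for x y and m :: int
  proof -
    have xD: "x \<in> Domain R" using x by blast
    have bp: "b [^]\<^bsub>G\<^esub> int p \<in> Domain R" using b by (simp add: int_pow_int)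
    show notin: "x \<otimes>\<^bsub>G\<^esub> b [^]\<^bsub>G\<^esub> m \<notin> Domain R"
    proof
      assume "x \<otimes>\<^bsub>G\<^esub> b [^]\<^bsub>G\<^esub> m \<in> Domain R"
      then have "inv\<^bsub>G\<^esub> x \<otimes>\<^bsub>G\<^esub> (x \<otimes>\<^bsub>G\<^esub> b [^]\<^bsub>G\<^esub> m) \<in> Domain R"
        using xD by blast
      then have "b [^]\<^bsub>G\<^esub> m \<in> Domain R"
        using Rc[OF x] b by (simp add: G.m_assoc[symmetric])
      moreover have "coprime m (int p)"
        using m assms(1) prime_imp_coprime[of "int p" m] by (simp add: coprime_commute)
      ultimately show False
        using G.pow_coprime_mem_subgroup[OF D b(1) _ bp] b(2) by blast
    qed
    fix j assume j: "x \<otimes>\<^bsub>G\<^esub> b [^]\<^bsub>G\<^esub> m \<in> power_image G (p ^ j)"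
    have "(x \<otimes>\<^bsub>G\<^esub> b [^]\<^bsub>G\<^esub> m) [^]\<^bsub>G\<^esub> p = x [^]\<^bsub>G\<^esub> int p \<otimes>\<^bsub>G\<^esub> (b [^]\<^bsub>G\<^esub> int p) [^]\<^bsub>G\<^esub> m"
      using Rc[OF x] b
      by (simp only: int_pow_int[symmetric] G.int_pow_distrib G.int_pow_pow G.int_pow_closed mult.commute[of m])
    also have "\<dots> \<in> Domain R"
      by (intro D.m_closed G.subgroup_int_pow_closed[OF D] xD bp)
    finally have "Q j (x \<otimes>\<^bsub>G\<^esub> b [^]\<^bsub>G\<^esub> m)"
      using notin j Rc[OF x] b by (simp add: Q_def)
    then show "j \<le> k" using max by blast
  qed
  have multiple_case: "(x \<otimes>\<^bsub>G\<^esub> b [^]\<^bsub>G\<^esub> m, y \<otimes>\<^bsub>A\<^esub> c [^]\<^bsub>A\<^esub> m) \<in> R"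
    if x: "(x, y) \<in> R" and m: "int p dvd m" for x y and m :: int
  proof -
    obtain q where q: "m = int p * q" using m by blast
    have "(b [^]\<^bsub>G\<^esub> m, c [^]\<^bsub>A\<^esub> m) = (b [^]\<^bsub>G\<^esub> p, d) [^]\<^bsub>G \<times>\<times> A\<^esub> q"
      using b c cA q
      by (simp add: int_pow_DirProd G.is_group A.is_group G.int_pow_pow[symmetric]
          A.int_pow_pow[symmetric] int_pow_int)
    also have "\<dots> \<in> R" by (rule P.subgroup_int_pow_closed[OF RP d])
    finally have "(x, y) \<otimes>\<^bsub>G \<times>\<times> A\<^esub> (b [^]\<^bsub>G\<^esub> m, c [^]\<^bsub>A\<^esub> m) \<in> R" by (rule R.m_closed[OF x])
    then show ?thesis by simp
  qed
  have "height_graph p N G A R'"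
    unfolding height_graph_def
  proof (intro conjI allI impI R'P)
    fix x' y' assume "(x', y') \<in> R'"
    then obtain x y and m :: int where xy: "(x, y) \<in> R" and
        x': "x' = x \<otimes>\<^bsub>G\<^esub> b [^]\<^bsub>G\<^esub> m" and y': "y' = y \<otimes>\<^bsub>A\<^esub> c [^]\<^bsub>A\<^esub> m"
      by (auto simp: R'_iff)
    show "y' = \<one>\<^bsub>A\<^esub>" if "x' = \<one>\<^bsub>G\<^esub>"
    proof (cases "int p dvd m")
      case True
      then show ?thesis using multiple_case[OF xy] x' y' that height_graphD(2)[OF R] by simp
    next
      case False
      then show ?thesis using coprime_case(1)[OF xy False] x' that D.one_closed by simp
    qed
    fix j assume j: "j \<le> N" "x' \<in> power_image G (p ^ j)"
    show "y' \<in> power_image A (p ^ j)"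
    proof (cases "int p dvd m")
      case True
      then show ?thesis
        using multiple_case[OF xy] x' y' j height_graphD(3)[OF R] by blast
    next
      case False
      then have "j \<le> k" using coprime_case(2)[OF xy] j x' by blast
      interpret Gj: subgroup "power_image G (p ^ j)" G by (rule G.subgroup_power_image)
      interpret Aj: subgroup "power_image A (p ^ j)" A by (rule A.subgroup_power_image)
      have "b \<in> power_image G (p ^ j)" "c \<in> power_image A (p ^ j)"
        using b c \<open>j \<le> k\<close> G.power_image_antimono A.power_image_antimono by blast+
      then have bm: "b [^]\<^bsub>G\<^esub> m \<in> power_image G (p ^ j)" and cm: "c [^]\<^bsub>A\<^esub> m \<in> power_image A (p ^ j)"
        by (simp_all add: G.subgroup_int_pow_closed[OF Gj.subgroup_axioms]
            A.subgroup_int_pow_closed[OF Aj.subgroup_axioms])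
      have "x = x' \<otimes>\<^bsub>G\<^esub> inv\<^bsub>G\<^esub> (b [^]\<^bsub>G\<^esub> m)"
        using Rc[OF xy] b x' by (simp add: G.m_assoc)
      then have "x \<in> power_image G (p ^ j)" using bm j by simp
      then have "y \<in> power_image A (p ^ j)" using height_graphD(3)[OF R xy] j by blast
      then show ?thesis using y' cm by blast
    qed
  qed
  moreover have "R \<subseteq> R'"
  proof (rule subrelI)
    fix x y assume "(x, y) \<in> R"
    then show "(x, y) \<in> R'"
      using Rc[of x y] by (subst R'_iff) (rule exI[of _ x], rule exI[of _ y], rule exI[of _ 0], simp)
  qed
  moreover have "(b, c) \<in> R'"
    using b cA R.one_closed by (subst R'_iff) (rule exI[of _ "\<one>\<^bsub>G\<^esub>"], rule exI[of _ "\<one>\<^bsub>A\<^esub>"], rule exI[of _ 1], simp)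
  ultimately show ?thesis using b(2) by blast
qed

lemma (in group) subgroup_Union_chain:
  assumes "\<C> \<noteq> {}" and sub: "\<And>X. X \<in> \<C> \<Longrightarrow> subgroup X G"
    and chain: "\<And>X Y. X \<in> \<C> \<Longrightarrow> Y \<in> \<C> \<Longrightarrow> X \<subseteq> Y \<or> Y \<subseteq> X"
  shows "subgroup (\<Union>\<C>) G"
proof (rule subgroupI)
  show "\<Union>\<C> \<subseteq> carrier G" using subgroup.subset[OF sub] by blast
  show "\<Union>\<C> \<noteq> {}" using assms(1) subgroup.one_closed[OF sub] by blast
  show "inv a \<in> \<Union>\<C>" if "a \<in> \<Union>\<C>" for a
    using that subgroup.m_inv_closed[OF sub] by blast
  show "a \<otimes> b \<in> \<Union>\<C>" if ab: "a \<in> \<Union>\<C>" "b \<in> \<Union>\<C>" for a b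
  proof -
    obtain X Y where XY: "X \<in> \<C>" "a \<in> X" "Y \<in> \<C>" "b \<in> Y" using ab by blast
    then obtain Z where "Z \<in> \<C>" "a \<in> Z" "b \<in> Z" using chain[OF XY(1,3)] by blast
    then show ?thesis using subgroup.m_closed[OF sub] by blast
  qed
qed

lemma height_graph_Union_chain:
  assumes "group G" "group A" "\<C> \<noteq> {}" and sub: "\<And>R. R \<in> \<C> \<Longrightarrow> height_graph p N G A R"
    and chain: "\<And>X Y. X \<in> \<C> \<Longrightarrow> Y \<in> \<C> \<Longrightarrow> X \<subseteq> Y \<or> Y \<subseteq> X"
  shows "height_graph p N G A (\<Union>\<C>)"
  unfolding height_graph_def
proof (intro conjI allI impI)
  show "subgroup (\<Union>\<C>) (G \<times>\<times> A)"
    by (rule group.subgroup_Union_chain[OF DirProd_group])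
      (use assms height_graphD(1)[OF sub] in auto)
qed (use height_graphD(2,3)[OF sub] in blast)+

lemma hom_of_total_height_graph:
  assumes "comm_group G" "comm_group A" and M: "height_graph p N G A M" and "carrier G \<subseteq> Domain M"
  obtains g where "g \<in> hom G A" "\<And>x y. (x, y) \<in> M \<Longrightarrow> g x = y"
proof -
  interpret G: comm_group G by fact
  interpret A: comm_group A by fact
  interpret P: comm_group "G \<times>\<times> A" using assms(1,2) by (rule comm_group_DirProd)
  interpret M: subgroup M "G \<times>\<times> A" by (rule height_graphD(1)[OF M])
  have Mc: "x \<in> carrier G" "y \<in> carrier A" if "(x, y) \<in> M" for x y
    using M.mem_carrier[OF that] by auto
  have uniq: "y = y'" if xy: "(x, y) \<in> M" "(x, y') \<in> M" for x y y'
  proof -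
    have "(x, y) \<otimes>\<^bsub>G \<times>\<times> A\<^esub> inv\<^bsub>G \<times>\<times> A\<^esub> (x, y') \<in> M"
      using xy by blast
    then have "(\<one>\<^bsub>G\<^esub>, y \<otimes>\<^bsub>A\<^esub> inv\<^bsub>A\<^esub> y') \<in> M"
      using Mc[OF xy(1)] Mc[OF xy(2)] by (simp add: G.is_group A.is_group)
    then have "y \<otimes>\<^bsub>A\<^esub> inv\<^bsub>A\<^esub> y' = \<one>\<^bsub>A\<^esub>" by (rule height_graphD(2)[OF M])
    then show "y = y'"
      using Mc[OF xy(1)] Mc[OF xy(2)] by (metis A.inv_equality A.inv_inv A.inv_closed)
  qed
  define g where "g x = (THE y. (x, y) \<in> M)" for x
  have g: "g x = y" if "(x, y) \<in> M" for x y
    unfolding g_def using that uniq by blast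
  have gM: "(x, g x) \<in> M" if "x \<in> carrier G" for x
    using that assms(4) g by auto
  have "g \<in> hom G A"
  proof (rule homI)
    show "g x \<in> carrier A" if "x \<in> carrier G" for x
      using Mc(2)[OF gM[OF that]] .
    show "g (x \<otimes>\<^bsub>G\<^esub> y) = g x \<otimes>\<^bsub>A\<^esub> g y" if "x \<in> carrier G" "y \<in> carrier G" for x y
      using M.m_closed[OF gM[OF that(1)] gM[OF that(2)]] by (intro g) simp
  qed
  then show thesis using g by (rule that)
qed

section \<open>Extending height-increasing homomorphisms\<close>

text \<open>
  The starting point for Zorn's lemma is \<open>f\<close> on \<open>H\<close> together with the trivial map on the \<open>p ^ N\<close>-th
  powers. Multiplying \<open>x \<in> H\<close> by a \<open>p ^ N\<close>-th power \<open>c\<close> does not change membership in the \<open>p ^ j\<close>-th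
  powers for \<open>j \<le> N\<close>, so the height condition is inherited from \<open>f\<close>. It is also well defined: if
  \<open>x c = \<one>\<close>, then \<open>x\<close> is a \<open>p ^ N\<close>-th power in \<open>H\<close>, hence trivial.
\<close>

theorem extend_height_increasing_hom:
  assumes "prime p" "comm_group G" "p_group p G" "comm_group A"
    and H: "subgroup H G" "H \<inter> power_image G (p ^ N) \<subseteq> {\<one>\<^bsub>G\<^esub>}"
    and f: "f \<in> hom (G\<lparr>carrier := H\<rparr>) A"
    and incr: "\<And>k x. x \<in> H \<Longrightarrow> x \<in> power_image G (p ^ k) \<Longrightarrow> f x \<in> power_image A (p ^ k)"
  shows "\<exists>g\<in>hom G A. \<forall>x\<in>H. g x = f x"
proof -
  interpret G: comm_group G by fact
  interpret A: comm_group A by fact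
  interpret P: comm_group "G \<times>\<times> A" using assms(2,4) by (rule comm_group_DirProd)
  interpret H: subgroup H G by fact
  have f1: "f \<one>\<^bsub>G\<^esub> = \<one>\<^bsub>A\<^esub>"
    using hom_one[OF f] H.subgroup_is_group[OF G.is_group] A.is_group by simp
  have fc: "f x \<in> carrier A" if "x \<in> H" for x
    using f that by (auto simp: hom_def)
  define R0 where "R0 = (\<lambda>x. (x, f x)) ` H <#>\<^bsub>G \<times>\<times> A\<^esub> power_image G (p ^ N) \<times> {\<one>\<^bsub>A\<^esub>}"
  have R0_iff: "z \<in> R0 \<longleftrightarrow> (\<exists>x\<in>H. \<exists>c\<in>power_image G (p ^ N). z = (x \<otimes>\<^bsub>G\<^esub> c, f x))" for z
    using fc by (force simp: R0_def set_mult_def)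
  have graph_f: "subgroup ((\<lambda>x. (x, f x)) ` H) (G \<times>\<times> A)"
  proof -
    have "group_hom (G\<lparr>carrier := H\<rparr>) (G \<times>\<times> A) (\<lambda>x. (x, f x))"
      using f H.mem_carrier H.subgroup_is_group[OF G.is_group] P.is_group
      by (intro group_hom.intro group_hom_axioms.intro) (auto simp: hom_def)
    from group_hom.img_is_subgroup[OF this] show ?thesis by simp
  qed
  have "height_graph p N G A R0"
    unfolding height_graph_def
  proof (intro conjI allI impI)
    show "subgroup R0 (G \<times>\<times> A)"
      unfolding R0_def
      by (intro P.mult_subgroups graph_f DirProd_subgroups G.subgroup_power_image
          A.triv_subgroup G.is_group A.is_group)
    fix x' y' assume "(x', y') \<in> R0"
    then obtain x c where x: "x \<in> H" "c \<in> power_image G (p ^ N)" "x' = x \<otimes>\<^bsub>G\<^esub> c" "y' = f x"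
      by (auto simp: R0_iff)
    have mem: "x \<in> power_image G (p ^ j)" if "x' \<in> power_image G (p ^ j)" "j \<le> N" for j
    proof -
      interpret Gj: subgroup "power_image G (p ^ j)" G by (rule G.subgroup_power_image)
      have c: "c \<in> power_image G (p ^ j)" using x(2) G.power_image_antimono[OF that(2)] by blast
      have "x = x' \<otimes>\<^bsub>G\<^esub> inv\<^bsub>G\<^esub> c"
        using x c by (simp add: G.m_assoc)
      then show ?thesis using c that(1) by simp
    qed
    show "y' \<in> power_image A (p ^ j)" if "j \<le> N" "x' \<in> power_image G (p ^ j)" for j
      using incr[OF x(1) mem] that x(4) by simp
    show "y' = \<one>\<^bsub>A\<^esub>" if "x' = \<one>\<^bsub>G\<^esub>"
      using mem[of N] that H x f1 subgroup.one_closed[OF G.subgroup_power_image] by auto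
  qed
  define S where "S = {R. height_graph p N G A R \<and> R0 \<subseteq> R}"
  have "\<exists>M\<in>S. \<forall>X\<in>S. M \<subseteq> X \<longrightarrow> X = M"
  proof (rule subset_Zorn_nonempty)
    show "S \<noteq> {}" using \<open>height_graph p N G A R0\<close> by (auto simp: S_def)
    fix \<C> assume \<C>: "\<C> \<noteq> {}" "subset.chain S \<C>"
    then have "height_graph p N G A (\<Union>\<C>)"
      by (intro height_graph_Union_chain G.is_group A.is_group)
        (auto simp: subset_chain_def S_def)
    moreover have "R0 \<subseteq> \<Union>\<C>"
      using \<C> unfolding subset_chain_def S_def by fast
    ultimately show "\<Union>\<C> \<in> S" by (simp add: S_def)
  qed
  then obtain M where M: "height_graph p N G A M" "R0 \<subseteq> M"
      and max: "\<And>X. height_graph p N G A X \<Longrightarrow> M \<subseteq> X \<Longrightarrow> X = M"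
    by (auto simp: S_def)
  have "carrier G \<subseteq> Domain M"
  proof (rule ccontr)
    assume "\<not> carrier G \<subseteq> Domain M"
    then obtain b where b: "b \<in> carrier G" "b \<notin> Domain M" by blast
    have "power_image G (p ^ N) \<subseteq> Domain M"
    proof
      fix c assume c: "c \<in> power_image G (p ^ N)"
      then have "c \<in> carrier G" by (auto simp: power_image_def)
      then have "(c, f \<one>\<^bsub>G\<^esub>) \<in> R0"
        unfolding R0_iff using c by (intro bexI[of _ "\<one>\<^bsub>G\<^esub>"] bexI[of _ c]) simp_all
      then show "c \<in> Domain M" using M(2) by blast
    qed
    then show False
      using extend_height_graph[OF assms(1-4) M(1) _ b] max by blast
  qed
  then obtain g where g: "g \<in> hom G A" "\<And>x y. (x, y) \<in> M \<Longrightarrow> g x = y"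
    using hom_of_total_height_graph[OF assms(2,4) M(1)] by blast
  have "g x = f x" if "x \<in> H" for x
  proof (rule g(2))
    have "(x, f x) \<in> R0"
      unfolding R0_iff using that subgroup.one_closed[OF G.subgroup_power_image]
      by (intro bexI[of _ x] bexI[of _ "\<one>\<^bsub>G\<^esub>"]) simp_all
    then show "(x, f x) \<in> M" using M(2) by blast
  qed
  then show ?thesis using g(1) by blast
qed

section \<open>Heights\<close>

lemma divisible_subset_p_power:
  assumes "group G" "divisible_subgroup D G" "p > 0"
  shows "D \<subseteq> p_power p G (\<sigma> :: 'o::wellorder)"
proof (induction \<sigma> rule: less_induct)
  case (less \<sigma>)
  have "D \<subseteq> (\<lambda>x. x [^]\<^bsub>G\<^esub> p) ` p_power p G \<tau>" if "\<tau> < \<sigma>" for \<tau>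
  proof
    fix x assume "x \<in> D"
    then obtain w where "w \<in> D" "w [^]\<^bsub>G\<^esub> p = x"
      using assms(2,3) unfolding divisible_subgroup_def by blast
    then show "x \<in> (\<lambda>x. x [^]\<^bsub>G\<^esub> p) ` p_power p G \<tau>" using less[OF that] by blast
  qed
  moreover have "D \<subseteq> carrier G"
    using assms(2) by (simp add: divisible_subgroup_def subgroup.subset)
  ultimately show ?case by (subst subset_iff, subst p_power_iff) blast
qed

lemma divisible_subset_power_image:
  assumes "divisible_subgroup D G" "m > 0"
  shows "D \<subseteq> power_image G m"
proof
  fix x assume "x \<in> D"
  then obtain w where "w \<in> D" "w [^]\<^bsub>G\<^esub> m = x"
    using assms unfolding divisible_subgroup_def by blast
  moreover have "D \<subseteq> carrier G"
    using assms by (simp add: divisible_subgroup_def subgroup.subset)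
  ultimately show "x \<in> power_image G m" unfolding power_image_def by blast
qed

locale abelian_p_group = comm_group G for G :: "('a, 'b) monoid_scheme" (structure) +
  fixes p :: nat
  assumes prime_p: "prime p" and p_group: "p_group p G"
begin

lemma height_divisible: "x \<in> divisible_part G \<Longrightarrow> height p G x = Pinf"
  by (simp add: height_def)

lemma height_FinD:
  assumes "x \<in> carrier G" "height p G x = Fin \<sigma>"
  shows "x \<in> p_power p G \<sigma>" "x \<notin> (\<lambda>y. y [^] p) ` p_power p G \<sigma>"
proof -
  have nd: "x \<notin> divisible_part G" using assms(2) by (auto simp: height_def)
  have "\<sigma> = (THE \<sigma>. x \<in> p_power p G \<sigma> \<and> x \<notin> (\<lambda>y. y [^] p) ` p_power p G \<sigma>)"
    using assms(2) nd by (simp add: height_def)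
  then show "x \<in> p_power p G \<sigma>" "x \<notin> (\<lambda>y. y [^] p) ` p_power p G \<sigma>"
    using theI'[OF ex1_height[OF comm_group_axioms prime_p p_group assms(1) nd]] by blast+
qed

lemma height_cases:
  obtains "x \<in> divisible_part G" "height p G x = Pinf"
  | \<sigma> where "x \<notin> divisible_part G" "height p G x = Fin \<sigma>"
  by (auto simp: height_def)

lemma divisible_part_subset_p_power: "divisible_part G \<subseteq> p_power p G (\<sigma> :: 'a ordinal)"
  using divisible_subset_p_power[OF is_group] prime_gt_0_nat[OF prime_p]
  by (auto simp: divisible_part_def)

text \<open>
  Replaces reasoning about the definite description in \<open>height\<close> by membership in subgroups. It also
  covers the elements of the divisible part, which lie in \<open>p\<^sup>\<sigma>G\<close> for every \<open>\<sigma>\<close>.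
\<close>

lemma Fin_le_height_iff:
  assumes "x \<in> carrier G"
  shows "Fin \<sigma> \<le> height p G x \<longleftrightarrow> x \<in> p_power p G \<sigma>"
proof (cases x rule: height_cases)
  case 1
  then show ?thesis using divisible_part_subset_p_power by auto
next
  case (2 \<tau>)
  note \<tau> = height_FinD[OF assms 2(2)]
  have "x \<notin> p_power p G \<sigma>" if "\<tau> < \<sigma>"
    using \<tau>(2) that unfolding p_power_iff[of _ p G \<sigma>] by blast
  then show ?thesis
    using 2 \<tau>(1) p_power_antimono[of \<sigma> \<tau> p G] by (cases "\<sigma> \<le> \<tau>") auto
qed

lemma height_one: "height p G \<one> = Pinf"
  using triv_subgroup
  by (intro height_divisible) (auto simp: divisible_part_def divisible_subgroup_def intro!: exI[of _ "{\<one>}"])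

text \<open>
  An element of \<open>p\<^sup>kG\<close> outside \<open>p\<^bsup>\<sigma>+1\<^esup>G\<close> forces \<open>\<sigma> \<ge> k\<close>, and so \<open>p\<^sup>\<sigma>G \<subseteq> p\<^sup>kG\<close>. Stating the conclusion as
  an inclusion avoids embedding the finite ordinals into the type of ordinals; a \<open>p\<close>-th root \<open>w\<close> of \<open>x\<close>
  carries the induction, since it is missed by some \<open>p\<^bsup>\<tau>+1\<^esup>G\<close> with \<open>\<tau> < \<sigma>\<close>.
\<close>

lemma p_power_subset_power_image:
  assumes "x \<in> power_image G (p ^ k)" "x \<notin> (\<lambda>y. y [^] p) ` p_power p G (\<sigma> :: 'o::wellorder)"
  shows "p_power p G \<sigma> \<subseteq> power_image G (p ^ k)"
  using assms
proof (induction k arbitrary: x \<sigma>)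
  case 0
  have "power_image G (p ^ 0) = carrier G" by (auto simp: power_image_def)
  then show ?case using p_power_subset[of p G \<sigma>] by simp
next
  case (Suc k)
  then obtain w where w: "w \<in> power_image G (p ^ k)" "x = w [^] p"
    unfolding power_image_Suc by blast
  then have "w \<notin> p_power p G \<sigma>" "w \<in> carrier G"
    using Suc.prems(2) by (auto simp: power_image_def)
  then obtain \<tau> where \<tau>: "\<tau> < \<sigma>" "w \<notin> (\<lambda>y. y [^] p) ` p_power p G \<tau>"
    unfolding p_power_iff[of _ p G \<sigma>] by blast
  have "p_power p G \<sigma> \<subseteq> (\<lambda>y. y [^] p) ` p_power p G \<tau>"
    using \<tau>(1) unfolding p_power_iff[of _ p G \<sigma>] subset_iff by blast
  also have "\<dots> \<subseteq> power_image G (p ^ Suc k)"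
    unfolding power_image_Suc using Suc.IH[OF w(1) \<tau>(2)] by (rule image_mono)
  finally show ?case .
qed

text \<open>
  The link between the ordinal-valued heights and the finite powers: it turns an inequality of
  heights into the hypothesis of \<open>extend_height_increasing_hom\<close>.
\<close>

lemma height_le_power_image:
  assumes "x \<in> carrier G" "y \<in> carrier G" "height p G x \<le> height p G y"
    and x: "x \<in> power_image G (p ^ k)"
  shows "y \<in> power_image G (p ^ k)"
proof (cases y rule: height_cases)
  case 1
  then obtain D where "divisible_subgroup D G" "y \<in> D" by (auto simp: divisible_part_def)
  then show ?thesis
    using divisible_subset_power_image[of D G "p ^ k"] prime_gt_0_nat[OF prime_p] by auto
next
  case (2 \<tau>)
  then obtain \<sigma> where \<sigma>: "height p G x = Fin \<sigma>"
    using assms(3) by (cases x rule: height_cases) auto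
  then have "y \<in> p_power p G \<sigma>" using assms(2,3) Fin_le_height_iff by simp
  then show ?thesis
    using p_power_subset_power_image[OF x height_FinD(2)[OF assms(1) \<sigma>]] by blast
qed

lemma hom_p_power:
  assumes g: "g \<in> hom G G" and "x \<in> p_power p G (\<sigma> :: 'o::wellorder)"
  shows "g x \<in> p_power p G \<sigma>"
  using assms(2)
proof (induction \<sigma> arbitrary: x rule: less_induct)
  case (less \<sigma>)
  have x: "x \<in> carrier G" using less.prems p_power_subset[of p G \<sigma>] by blast
  have "g x \<in> (\<lambda>y. y [^] p) ` p_power p G \<tau>" if \<tau>: "\<tau> < \<sigma>" for \<tau>
  proof -
    obtain w where w: "w \<in> p_power p G \<tau>" "x = w [^] p"
      using less.prems \<tau> unfolding p_power_iff[of _ p G \<sigma>] by blast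
    then have "w \<in> carrier G" using p_power_subset[of p G \<tau>] by blast
    then have "g x = g w [^] p" using w hom_nat_pow[OF g _ is_group is_group] by simp
    then show ?thesis using less.IH[OF \<tau> w(1)] by blast
  qed
  then show ?case
    using x g unfolding p_power_iff[of _ p G \<sigma>] by (auto simp: hom_def)
qed

lemma hom_divisible_part:
  assumes g: "g \<in> hom G G" and "x \<in> divisible_part G"
  shows "g x \<in> divisible_part G"
proof -
  have hom: "group_hom G G g"
    using g by (intro group_hom.intro group_hom_axioms.intro is_group)
  obtain D where D: "divisible_subgroup D G" "x \<in> D"
    using assms(2) by (auto simp: divisible_part_def)
  have sub: "D \<subseteq> carrier G" using D by (simp add: divisible_subgroup_def subgroup.subset)
  have "divisible_subgroup (g ` D) G"
    unfolding divisible_subgroup_def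
  proof (intro conjI allI impI ballI)
    show "subgroup (g ` D) G"
      using D by (intro group_hom.subgroup_img_is_subgroup[OF hom]) (simp add: divisible_subgroup_def)
    fix n :: nat and y assume "n > 0" "y \<in> g ` D"
    then obtain w where "w \<in> D" "y = g (w [^] n)"
      using D(1) unfolding divisible_subgroup_def by (metis imageE)
    then show "\<exists>w\<in>g ` D. w [^] n = y"
      using sub by (intro bexI[of _ "g w"]) (auto simp: group_hom.hom_nat_pow[OF hom])
  qed
  then show ?thesis using D(2) by (auto simp: divisible_part_def)
qed

lemma height_le_hom:
  assumes g: "g \<in> hom G G" and x: "x \<in> carrier G"
  shows "height p G x \<le> height p G (g x)"
proof (cases x rule: height_cases)
  case 1
  then show ?thesis using hom_divisible_part[OF g] height_divisible by simp
next
  case (2 \<sigma>)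
  have "g x \<in> carrier G" using g x by (auto simp: hom_def)
  then show ?thesis
    using hom_p_power[OF g height_FinD(1)[OF x 2(2)]] Fin_le_height_iff 2 by simp
qed

end

section \<open>Homomorphisms out of direct sums of cyclic groups\<close>

lemma (in group) hom_subgroup_int_pow:
  assumes "subgroup H G" "f \<in> hom (G\<lparr>carrier := H\<rparr>) G" "x \<in> H"
  shows "f (x [^] (m::int)) = f x [^] m"
  using hom_int_pow[OF assms(2) _ subgroup_imp_group[OF assms(1)] is_group] assms(3)
    int_pow_consistent[OF assms(1,3)] by simp

text \<open>
  Membership is all that is needed of the image of a product. The equation \<open>f (\<Prod> y\<^sub>j) = \<Prod> f y\<^sub>j\<close> would
  bring in products in \<open>G\<lparr>carrier := H\<rparr>\<close> besides those in \<open>G\<close>.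
\<close>

lemma (in comm_group) hom_finprod_mem_subgroup:
  assumes H: "subgroup H G" and P: "subgroup P G" and f: "f \<in> hom (G\<lparr>carrier := H\<rparr>) G"
    and "finite J" and y: "\<And>j. j \<in> J \<Longrightarrow> y j \<in> H" "\<And>j. j \<in> J \<Longrightarrow> f (y j) \<in> P"
  shows "finprod G y J \<in> H \<and> f (finprod G y J) \<in> P"
  using \<open>finite J\<close> y
proof (induction J rule: finite_induct)
  case empty
  have "f \<one> = \<one>"
    using hom_one[OF f subgroup_imp_group[OF H] is_group] by simp
  then show ?case using subgroup.one_closed[OF H] subgroup.one_closed[OF P] by simp
next
  case (insert j J)
  then have IH: "finprod G y J \<in> H" "f (finprod G y J) \<in> P" and j: "y j \<in> H" "f (y j) \<in> P"
    by auto
  have "finprod G y (insert j J) = y j \<otimes> finprod G y J"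
    using insert.hyps insert.prems(1) subgroup.mem_carrier[OF H] by (intro finprod_insert) auto
  moreover have "f (y j \<otimes> finprod G y J) = f (y j) \<otimes> f (finprod G y J)"
    using hom_mult[OF f] j IH by simp
  ultimately show ?case
    using j IH subgroup.m_closed[OF H] subgroup.m_closed[OF P] by simp
qed

lemma (in comm_group) finprod_mem_subgroup:
  assumes "subgroup P G" "finite J" "\<And>j. j \<in> J \<Longrightarrow> y j \<in> P"
  shows "finprod G y J \<in> P"
  using hom_finprod_mem_subgroup[OF assms(1,1) _ assms(2), of "\<lambda>x. x" y] assms(1,3)
  by (simp add: hom_def Pi_def subgroup.mem_carrier)

text \<open>
  The map \<open>a\<^sup>k \<mapsto> b\<^sup>k\<close> does not depend on the choice of \<open>k\<close>, because the order of \<open>b\<close> divides that of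
  \<open>a\<close>. Infinite order is included, as \<open>ord a = 0\<close> then.
\<close>

lemma (in group) hom_from_cyclic:
  assumes a: "a \<in> carrier G" and H: "subgroup H G" and b: "b \<in> H" "b [^] ord a = \<one>"
  shows "\<exists>f\<in>hom (G\<lparr>carrier := generate G {a}\<rparr>) (G\<lparr>carrier := H\<rparr>). f a = b"
proof -
  have bG: "b \<in> carrier G" using b(1) H by (rule subgroup.mem_carrier[rotated])
  define f where "f x = b [^] (SOME k::int. x = a [^] k)" for x
  have f: "f (a [^] k) = b [^] k" for k :: int
  proof -
    have "\<exists>l. a [^] k = a [^] (l::int)" by blast
    then have "a [^] k = a [^] (SOME l::int. a [^] k = a [^] l)" by (rule someI_ex)
    then have "int (ord a) dvd k - (SOME l::int. a [^] k = a [^] l)"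
      using a by (metis int_pow_eq)
    moreover have "ord b dvd ord a" using b(2) bG by (simp add: pow_eq_id)
    ultimately have "int (ord b) dvd k - (SOME l::int. a [^] k = a [^] l)"
      by (meson dvd_trans int_dvd_int_iff)
    then show ?thesis using bG by (simp add: f_def int_pow_eq)
  qed
  have "f \<in> hom (G\<lparr>carrier := generate G {a}\<rparr>) (G\<lparr>carrier := H\<rparr>)"
  proof (rule homI)
    fix x assume "x \<in> carrier (G\<lparr>carrier := generate G {a}\<rparr>)"
    then obtain k :: int where "x = a [^] k" using a by (auto simp: generate_pow)
    then show "f x \<in> carrier (G\<lparr>carrier := H\<rparr>)"
      using subgroup_int_pow_closed[OF H b(1)] f by simp
    fix y assume "y \<in> carrier (G\<lparr>carrier := generate G {a}\<rparr>)"
    then obtain l :: int where "y = a [^] l" using a by (auto simp: generate_pow)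
    then show "f (x \<otimes>\<^bsub>G\<lparr>carrier := generate G {a}\<rparr>\<^esub> y) = f x \<otimes>\<^bsub>G\<lparr>carrier := H\<rparr>\<^esub> f y"
      using \<open>x = a [^] k\<close> a bG f by (simp flip: int_pow_mult)
  qed
  moreover have "f a = b" using f[of 1] a bG by simp
  ultimately show ?thesis by blast
qed

lemma (in comm_group) direct_sum_projection:
  assumes sum: "internal_direct_sum G H I K" and "i \<in> I"
  shows "\<exists>\<pi>\<in>hom (G\<lparr>carrier := H\<rparr>) (G\<lparr>carrier := K i\<rparr>).
    \<forall>x\<in>\<Pi>\<^sub>E i\<in>I. K i. \<pi> (finprod G x I) = x i"
proof -
  have K: "\<And>i. i \<in> I \<Longrightarrow> subgroup (K i) G"
    and bij: "bij_betw (\<lambda>x. finprod G x I) (\<Pi>\<^sub>E i\<in>I. K i) H"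
    using sum by (auto simp: internal_direct_sum_def)
  define \<pi> where "\<pi> h = the_inv_into (\<Pi>\<^sub>E i\<in>I. K i) (\<lambda>x. finprod G x I) h i" for h
  have \<pi>: "\<pi> (finprod G x I) = x i" if "x \<in> (\<Pi>\<^sub>E i\<in>I. K i)" for x
    using the_inv_into_f_f[OF bij_betw_imp_inj_on[OF bij] that] by (simp add: \<pi>_def)
  have "\<pi> \<in> hom (G\<lparr>carrier := H\<rparr>) (G\<lparr>carrier := K i\<rparr>)"
  proof (rule homI)
    fix h assume "h \<in> carrier (G\<lparr>carrier := H\<rparr>)"
    then obtain x where x: "x \<in> (\<Pi>\<^sub>E i\<in>I. K i)" "h = finprod G x I"
      using bij_betw_imp_surj_on[OF bij] by auto
    then show "\<pi> h \<in> carrier (G\<lparr>carrier := K i\<rparr>)" using \<pi> assms(2) by auto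
    fix h' assume "h' \<in> carrier (G\<lparr>carrier := H\<rparr>)"
    then obtain x' where x': "x' \<in> (\<Pi>\<^sub>E i\<in>I. K i)" "h' = finprod G x' I"
      using bij_betw_imp_surj_on[OF bij] by auto
    define s where "s = (\<lambda>i\<in>I. x i \<otimes> x' i)"
    have s: "s \<in> (\<Pi>\<^sub>E i\<in>I. K i)"
      using x(1) x'(1) subgroup.m_closed[OF K] by (auto simp: s_def PiE_iff)
    have xc: "x \<in> I \<rightarrow> carrier G" "x' \<in> I \<rightarrow> carrier G"
      using x(1) x'(1) subgroup.mem_carrier[OF K] by (auto simp: PiE_iff)
    have "finprod G s I = finprod G (\<lambda>i. x i \<otimes> x' i) I"
      using xc by (intro finprod_cong') (auto simp: s_def)
    also have "\<dots> = h \<otimes> h'" using xc x x' by simp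
    finally have "\<pi> (h \<otimes> h') = s i" using \<pi>[OF s] by simp
    then show "\<pi> (h \<otimes>\<^bsub>G\<lparr>carrier := H\<rparr>\<^esub> h') = \<pi> h \<otimes>\<^bsub>G\<lparr>carrier := K i\<rparr>\<^esub> \<pi> h'"
      using \<pi> x x' assms(2) by (simp add: s_def)
  qed
  then show ?thesis using \<pi> by blast
qed

lemma (in comm_group) direct_summand_as_finprod:
  assumes sum: "internal_direct_sum G H I K" and "finite I" "i \<in> I" "a \<in> K i"
  obtains x where "x \<in> (\<Pi>\<^sub>E i\<in>I. K i)" "x i = a" "finprod G x I = a"
proof
  have K: "\<And>i. i \<in> I \<Longrightarrow> subgroup (K i) G"
    using sum by (auto simp: internal_direct_sum_def)
  have a: "a \<in> carrier G" using subgroup.mem_carrier[OF K] assms by blast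
  show "(\<lambda>j\<in>I. if i = j then a else \<one>) \<in> (\<Pi>\<^sub>E i\<in>I. K i)"
    using assms subgroup.one_closed[OF K] by auto
  show "(\<lambda>j\<in>I. if i = j then a else \<one>) i = a" using assms by simp
  have "finprod G (\<lambda>j\<in>I. if i = j then a else \<one>) I = finprod G (\<lambda>j. if i = j then a else \<one>) I"
    using a by (intro finprod_cong') auto
  then show "finprod G (\<lambda>j\<in>I. if i = j then a else \<one>) I = a"
    using finprod_singleton[OF assms(3,2), of "\<lambda>_. a"] a by simp
qed

section \<open>Ulm sequences\<close>

context abelian_p_group
begin

lemma ord_gt_0: "x \<in> carrier G \<Longrightarrow> 0 < ord x"
  using p_group prime_gt_0_nat[OF prime_p] by (force simp: p_group_def)

lemma ulm_sequence_le_hom: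
  assumes g: "g \<in> hom G G" and x: "x \<in> carrier G"
  shows "ulm_sequence p G x \<le> ulm_sequence p G (g x)"
proof (rule le_funI)
  fix k
  have gx: "g x \<in> carrier G" using g x by (auto simp: hom_def)
  have g_pow: "g (x [^] n) = g x [^] n" for n :: nat
    by (rule hom_nat_pow[OF g x is_group is_group])
  have "g x [^] ord x = \<one>"
    using g_pow[of "ord x"] x hom_one[OF g is_group is_group] by simp
  then have "ord (g x) \<le> ord x"
    using gx ord_gt_0[OF x] by (simp add: pow_eq_id dvd_imp_le)
  then show "ulm_sequence p G x k \<le> ulm_sequence p G (g x) k"
    using height_le_hom[OF g, of "x [^] (p ^ k)"] x by (simp add: ulm_sequence_def g_pow)
qed

text \<open>
  The entry of index \<open>s\<close> in \<open>U(x)\<close> bounds the height of \<open>x [^] (p ^ s)\<close> even in the tail where it is \<open>\<infinity>\<close>.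
  So only the tail of \<open>U(y)\<close> needs an argument, and there \<open>y [^] (p ^ s)\<close> is trivial because the order
  of \<open>y\<close> is a power of \<open>p\<close>.
\<close>

lemma ulm_sequence_le_p_power_image:
  assumes x: "x \<in> carrier G" and y: "y \<in> carrier G"
    and U: "ulm_sequence p G x \<le> ulm_sequence p G y"
    and xs: "x [^] (p ^ s) \<in> power_image G (p ^ k)"
  shows "y [^] (p ^ s) \<in> power_image G (p ^ k)"
proof (cases "p ^ s < ord y")
  case False
  obtain m where m: "ord y = p ^ m" using p_group y by (auto simp: p_group_def)
  then have "m \<le> s"
    using False prime_gt_1_nat[OF prime_p] by (metis not_less power_increasing_iff)
  then have "ord y dvd p ^ s" unfolding m by (rule le_imp_power_dvd)
  then have "y [^] (p ^ s) = \<one>" using y by (simp add: pow_eq_id)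
  then show ?thesis using subgroup.one_closed[OF subgroup_power_image] by simp
next
  case True
  have "ulm_sequence p G x s \<le> height p G (y [^] (p ^ s))"
    using le_funD[OF U, of s] True by (simp add: ulm_sequence_def)
  moreover have "height p G (x [^] (p ^ s)) \<le> ulm_sequence p G x s"
    by (simp add: ulm_sequence_def)
  ultimately have "height p G (x [^] (p ^ s)) \<le> height p G (y [^] (p ^ s))"
    by simp
  then show ?thesis by (rule height_le_power_image[rotated 2]) (use x y xs in simp_all)
qed

text \<open>
  Exponents prime to \<open>p\<close> act invertibly, so only the \<open>p\<close>-part \<open>p ^ s\<close> of \<open>m\<close> matters, and this is
  what Ulm sequences record.
\<close>

lemma ulm_sequence_le_power_image:
  assumes x: "x \<in> carrier G" and y: "y \<in> carrier G"
    and U: "ulm_sequence p G x \<le> ulm_sequence p G y"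
    and xm: "x [^] (m::int) \<in> power_image G (p ^ k)"
  shows "y [^] m \<in> power_image G (p ^ k)"
proof (cases "m = 0")
  case True
  then show ?thesis using subgroup.one_closed[OF subgroup_power_image] by simp
next
  case False
  then obtain s u where su: "m = int p ^ s * u" "\<not> int p dvd u"
    using multiplicity_decompose'[of m "int p"] prime_p by (metis not_prime_unit prime_nat_int_transfer)
  have pow: "w [^] m = (w [^] (p ^ s)) [^] u" if "w \<in> carrier G" for w
    using that su(1) int_pow_pow[of w "int (p ^ s)" u] by (simp add: int_pow_int flip: of_nat_power)
  obtain r where r: "ord (x [^] (p ^ s)) = p ^ r" using p_group x by (auto simp: p_group_def)
  have "x [^] (p ^ s) \<in> power_image G (p ^ k)"
  proof (rule pow_coprime_mem_subgroup[OF subgroup_power_image])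
    show "(x [^] (p ^ s)) [^] u \<in> power_image G (p ^ k)" using xm pow x by simp
    have "(x [^] (p ^ s)) [^] int (p ^ r) = \<one>"
      using pow_ord_eq_1[of "x [^] (p ^ s)"] x r by (simp only: int_pow_int nat_pow_closed)
    then show "(x [^] (p ^ s)) [^] int (p ^ r) \<in> power_image G (p ^ k)"
      using subgroup.one_closed[OF subgroup_power_image] by simp
    show "coprime u (int (p ^ r))"
      using su(2) prime_p prime_imp_coprime[of "int p" u] by (simp add: coprime_commute)
  qed (use x in simp)
  then have "y [^] (p ^ s) \<in> power_image G (p ^ k)"
    by (rule ulm_sequence_le_p_power_image[OF x y U])
  then show ?thesis
    using pow[OF y] subgroup_int_pow_closed[OF subgroup_power_image] by simp
qed

lemma bounded_heights:
  assumes "finite H" "H \<inter> p_omega p G \<subseteq> {\<one>}"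
  shows "\<exists>N. H \<inter> power_image G (p ^ N) \<subseteq> {\<one>}"
proof -
  have "\<exists>n. h \<notin> power_image G (p ^ n)" if "h \<in> H - {\<one>}" for h
    using that assms(2) unfolding p_omega_def power_image_def by blast
  then obtain n where n: "\<And>h. h \<in> H - {\<one>} \<Longrightarrow> h \<notin> power_image G (p ^ n h)" by metis
  (* the sum is just a convenient upper bound of the finitely many n h *)
  have "H \<inter> power_image G (p ^ sum n H) \<subseteq> {\<one>}"
  proof
    fix h assume h: "h \<in> H \<inter> power_image G (p ^ sum n H)"
    then have "n h \<le> sum n H" using assms(1) by (intro member_le_sum) auto
    then have "h \<in> power_image G (p ^ n h)" using power_image_antimono h by blast
    then show "h \<in> {\<one>}" using n h by blast
  qed
  then show ?thesis ..
qed

end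

section \<open>Finite direct sums of cyclic groups\<close>

locale direct_sum_of_cyclics = abelian_p_group +
  fixes H :: "'a set" and I :: "'i set" and z :: "'i \<Rightarrow> 'a" and K :: "'i \<Rightarrow> 'a set"
  assumes finite_I: "finite I"
    and direct_sum: "internal_direct_sum G H I K"
    and z_closed: "i \<in> I \<Longrightarrow> z i \<in> carrier G"
    and K_eq: "i \<in> I \<Longrightarrow> K i = generate G {z i}"
begin

lemma subgroup_H: "subgroup H G" and subgroup_K: "i \<in> I \<Longrightarrow> subgroup (K i) G"
  using direct_sum by (auto simp: internal_direct_sum_def)

lemma H_eq: "H = (\<lambda>x. finprod G x I) ` (\<Pi>\<^sub>E i\<in>I. K i)"
  using direct_sum by (auto simp: internal_direct_sum_def bij_betw_def)

lemma K_subset: assumes "i \<in> I" shows "K i \<subseteq> H"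
proof
  fix a assume "a \<in> K i"
  then obtain x where "x \<in> (\<Pi>\<^sub>E i\<in>I. K i)" "finprod G x I = a"
    using direct_summand_as_finprod[OF direct_sum finite_I assms] by blast
  then show "a \<in> H" unfolding H_eq by blast
qed

lemma z_in_K: "i \<in> I \<Longrightarrow> z i \<in> K i"
  by (simp add: K_eq generate.incl)

text \<open>
  The endomorphism of \<open>H\<close> that is to be extended projects onto the cyclic group generated by \<open>z i\<close> and
  sends this generator to \<open>b\<close>.
\<close>

lemma ulm_sequence_le_if_extending:
  assumes W: "H \<in> \<W> G" and i: "i \<in> I" and b: "b \<in> H" "b [^] ord (z i) = \<one>"
  shows "ulm_sequence p G (z i) \<le> ulm_sequence p G b"
proof -
  obtain \<pi> where \<pi>: "\<pi> \<in> hom (G\<lparr>carrier := H\<rparr>) (G\<lparr>carrier := K i\<rparr>)"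
      "\<And>x. x \<in> (\<Pi>\<^sub>E i\<in>I. K i) \<Longrightarrow> \<pi> (finprod G x I) = x i"
    using direct_sum_projection[OF direct_sum i] by blast
  obtain f where f: "f \<in> hom (G\<lparr>carrier := K i\<rparr>) (G\<lparr>carrier := H\<rparr>)" "f (z i) = b"
    using hom_from_cyclic[OF z_closed[OF i] subgroup_H b] K_eq[OF i] by auto
  have "f \<circ> \<pi> \<in> hom (G\<lparr>carrier := H\<rparr>) (G\<lparr>carrier := H\<rparr>)"
    using \<pi>(1) f(1) by (rule Group.hom_compose)
  then obtain g where g: "g \<in> hom G G" "\<And>x. x \<in> H \<Longrightarrow> g x = f (\<pi> x)"
    using W unfolding extending_subgroups_def by fastforce
  obtain x where "x \<in> (\<Pi>\<^sub>E i\<in>I. K i)" "x i = z i" "finprod G x I = z i"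
    using direct_summand_as_finprod[OF direct_sum finite_I i z_in_K[OF i]] by blast
  then have "\<pi> (z i) = z i" using \<pi>(2) by metis
  then have "g (z i) = b" using g(2) f(2) z_in_K[OF i] K_subset[OF i] by auto
  then show ?thesis using ulm_sequence_le_hom[OF g(1) z_closed[OF i]] by simp
qed

lemma height_le_component_if_extending:
  assumes W: "H \<in> \<W> G" and i: "i \<in> I" and x: "x \<in> (\<Pi>\<^sub>E i\<in>I. K i)"
  shows "height p G (finprod G x I) \<le> height p G (x i)"
proof -
  obtain \<pi> where \<pi>: "\<pi> \<in> hom (G\<lparr>carrier := H\<rparr>) (G\<lparr>carrier := K i\<rparr>)"
      "\<pi> (finprod G x I) = x i"
    using direct_sum_projection[OF direct_sum i] x by blast
  have "\<pi> \<in> hom (G\<lparr>carrier := H\<rparr>) (G\<lparr>carrier := H\<rparr>)"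
    using \<pi>(1) K_subset[OF i] by (auto simp: hom_def)
  then obtain g where g: "g \<in> hom G G" "\<And>x. x \<in> H \<Longrightarrow> g x = \<pi> x"
    using W unfolding extending_subgroups_def by fastforce
  have H: "finprod G x I \<in> H" using x by (auto simp: H_eq)
  then have "finprod G x I \<in> carrier G" by (rule subgroup.mem_carrier[OF subgroup_H])
  from height_le_hom[OF g(1) this] show ?thesis using g(2)[OF H] \<pi>(2) by simp
qed

text \<open>
  If the minimum is an ordinal \<open>\<sigma>\<close>, this says that \<open>p\<^sup>\<sigma>G\<close> is closed under products. If it is \<open>\<infinity>\<close>,
  all components are divisible, thus in \<open>p\<^sup>\<omega>G\<close>, and so they are trivial.
\<close>

lemma Min_height_le_height_finprod:
  assumes p_omega: "H \<inter> p_omega p G \<subseteq> {\<one>}" and x: "x \<in> (\<Pi>\<^sub>E i\<in>I. K i)"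
  shows "Min (insert Pinf ((\<lambda>i. height p G (x i)) ` I)) \<le> height p G (finprod G x I)"
    (is "?M \<le> _")
proof -
  have le: "?M \<le> height p G (x i)" if "i \<in> I" for i
    using that finite_I by (intro Min_le) auto
  have xH: "x i \<in> H" if "i \<in> I" for i using that x K_subset by (auto simp: PiE_iff)
  have xc: "x i \<in> carrier G" if "i \<in> I" for i
    using xH[OF that] by (rule subgroup.mem_carrier[OF subgroup_H])
  have "?M \<in> insert Pinf ((\<lambda>i. height p G (x i)) ` I)"
    using finite_I by (intro Min_in) auto
  then consider "?M = Pinf" | \<sigma> where "?M = Fin \<sigma>"
    by (auto simp: height_def split: if_splits)
  then show ?thesis
  proof cases
    case 1
    have "x i = \<one>" if i: "i \<in> I" for i
    proof -
      have "x i \<in> divisible_part G"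
        using le[OF i] 1 by (cases "x i" rule: height_cases) auto
      then obtain D where D: "divisible_subgroup D G" "x i \<in> D"
        by (auto simp: divisible_part_def)
      have "x i \<in> power_image G (p ^ n)" for n
        using divisible_subset_power_image[OF D(1), of "p ^ n"] D(2)
          prime_gt_0_nat[OF prime_p] by auto
      then have "x i \<in> p_omega p G" by (simp add: p_omega_def power_image_def)
      then show ?thesis using xH[OF i] p_omega by blast
    qed
    then have "finprod G x I = \<one>" by (rule finprod_one_eqI)
    then show ?thesis by (simp add: height_one)
  next
    case 2
    have sub: "subgroup (p_power p G \<sigma>) G" by (rule subgroup_p_power[OF comm_group_axioms])
    have "x i \<in> p_power p G \<sigma>" if "i \<in> I" for i
      using le[OF that] 2 Fin_le_height_iff[OF xc[OF that]] by simp
    then have "finprod G x I \<in> p_power p G \<sigma>"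
      by (rule finprod_mem_subgroup[OF sub finite_I])
    then show ?thesis
      using 2 Fin_le_height_iff subgroup.mem_carrier[OF sub] by simp
  qed
qed

lemma valuated_direct_sum_if_extending:
  assumes "H \<in> \<W> G" "H \<inter> p_omega p G \<subseteq> {\<one>}"
  shows "valuated_direct_sum p G H I K"
  unfolding valuated_direct_sum_def
proof (intro conjI ballI direct_sum)
  fix x assume x: "x \<in> (\<Pi>\<^sub>E i\<in>I. K i)"
  have "height p G (finprod G x I) \<le> Min (insert Pinf ((\<lambda>i. height p G (x i)) ` I))"
    using height_le_component_if_extending[OF assms(1) _ x] finite_I by simp
  then show "height p G (finprod G x I) = Min (insert Pinf ((\<lambda>i. height p G (x i)) ` I))"
    using Min_height_le_height_finprod[OF assms(2) x] by (rule antisym)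
qed

text \<open>
  The reduction to powers of the generators uses that an element has no larger height than its
  components. For a power of \<open>z i\<close>, each component \<open>v j\<close> of the image of \<open>z i\<close> is a power of an element
  \<open>b\<close> whose Ulm sequence is at least that of \<open>z i\<close>: one of the two families of inequalities provides
  \<open>b\<close>, according to which of \<open>z i\<close> and \<open>z j\<close> has the larger order.
\<close>

lemma hom_preserves_power_image:
  assumes val: "valuated_direct_sum p G H I K"
    and ulm: "\<And>i j. i \<in> I \<Longrightarrow> j \<in> I \<Longrightarrow> ord (z j) \<le> ord (z i) \<Longrightarrow>
      ulm_sequence p G (z i) \<le> ulm_sequence p G (z j) \<and>
      ulm_sequence p G (z j) \<le> ulm_sequence p G (z i [^] (ord (z i) div ord (z j)))"
    and f: "f \<in> hom (G\<lparr>carrier := H\<rparr>) (G\<lparr>carrier := H\<rparr>)"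
    and x: "x \<in> H" "x \<in> power_image G (p ^ k)"
  shows "f x \<in> power_image G (p ^ k)"
proof -
  note P = subgroup_power_image[of "p ^ k"]
  have fG: "f \<in> hom (G\<lparr>carrier := H\<rparr>) G"
    using f subgroup.mem_carrier[OF subgroup_H] by (auto simp: hom_def)
  have cyclic: "f (z i) [^] (m::int) \<in> power_image G (p ^ k)"
    if i: "i \<in> I" and m: "z i [^] m \<in> power_image G (p ^ k)" for i m
  proof -
    have zH: "z i \<in> H" using z_in_K[OF i] K_subset[OF i] by blast
    then have wH: "f (z i) \<in> H" using f by (auto simp: hom_def)
    then obtain v where v: "v \<in> (\<Pi>\<^sub>E i\<in>I. K i)" "f (z i) = finprod G v I"
      unfolding H_eq by blast
    have v_pow: "v j [^] m \<in> power_image G (p ^ k)" if j: "j \<in> I" for j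
    proof -
      obtain \<pi> where \<pi>: "\<pi> \<in> hom (G\<lparr>carrier := H\<rparr>) (G\<lparr>carrier := K j\<rparr>)"
          "\<pi> (f (z i)) = v j"
        using direct_sum_projection[OF direct_sum j] v by auto
      have \<pi>G: "\<pi> \<in> hom (G\<lparr>carrier := H\<rparr>) G"
        using \<pi>(1) subgroup.mem_carrier[OF subgroup_K[OF j]] by (auto simp: hom_def)
      have "v j [^] int (ord (z i)) = \<pi> (f (z i [^] int (ord (z i))))"
        by (simp only: hom_subgroup_int_pow[OF subgroup_H fG zH]
            hom_subgroup_int_pow[OF subgroup_H \<pi>G wH] \<pi>(2))
      also have "z i [^] int (ord (z i)) = \<one>"
        using z_closed[OF i] by (simp add: int_pow_int)
      also have "\<pi> (f \<one>) = \<one>"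
        using hom_one[OF fG] hom_one[OF \<pi>G] subgroup_imp_group[OF subgroup_H] is_group by simp
      finally have vord: "v j [^] int (ord (z i)) = \<one>" .
      obtain q :: int where q: "v j = z j [^] q"
        using v(1) j K_eq[OF j] z_closed[OF j] by (auto simp: generate_pow PiE_iff)
      have "\<exists>b l. b \<in> carrier G \<and> ulm_sequence p G (z i) \<le> ulm_sequence p G b \<and> v j = b [^] (l::int)"
      proof (cases "ord (z j) \<le> ord (z i)")
        case True
        then show ?thesis using ulm[OF i j] q z_closed[OF j] by blast
      next
        case False
        (* v j is killed by the order of z i, which is smaller than that of z j,
           so the exponent q is divisible by the quotient of the two orders *)
        obtain a where a: "ord (z i) = p ^ a"
          using p_group z_closed[OF i] by (auto simp: p_group_def)
        obtain c where c: "ord (z j) = p ^ c"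
          using p_group z_closed[OF j] by (auto simp: p_group_def)
        have "a \<le> c"
          using False a c prime_gt_1_nat[OF prime_p] by (metis nat_le_linear power_increasing_iff)
        then have ord_j: "ord (z j) = p ^ (c - a) * p ^ a"
          using c by (simp flip: power_add)
        have "z j [^] (q * int (p ^ a)) = \<one>"
          using vord q a z_closed[OF j] by (simp add: int_pow_pow)
        then have "int (p ^ (c - a)) * int (p ^ a) dvd q * int (p ^ a)"
          using z_closed[OF j] ord_j by (simp add: int_pow_eq_id)
        then have "int (p ^ (c - a)) dvd q"
          using prime_gt_0_nat[OF prime_p] by simp
        then obtain l where "q = int (p ^ (c - a)) * l" by blast
        then have "v j = (z j [^] (p ^ (c - a))) [^] l"
          using q z_closed[OF j] int_pow_pow[of "z j" "int (p ^ (c - a))" l]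
          by (simp only: int_pow_int)
        moreover have "ulm_sequence p G (z i) \<le> ulm_sequence p G (z j [^] (p ^ (c - a)))"
          using ulm[OF j i] False a ord_j prime_gt_0_nat[OF prime_p] by simp
        ultimately show ?thesis using z_closed[OF j] by blast
      qed
      then obtain b and l :: int where b: "b \<in> carrier G"
          "ulm_sequence p G (z i) \<le> ulm_sequence p G b" "v j = b [^] l" by blast
      have "b [^] m \<in> power_image G (p ^ k)"
        by (rule ulm_sequence_le_power_image[OF z_closed[OF i] b(1,2) m])
      then have "(b [^] m) [^] l \<in> power_image G (p ^ k)"
        by (rule subgroup_int_pow_closed[OF P])
      then show ?thesis using b by (simp add: int_pow_pow mult.commute)
    qed
    have "(\<lambda>w. w [^] m) \<in> hom (G\<lparr>carrier := H\<rparr>) G"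
      using subgroup.mem_carrier[OF subgroup_H] by (auto simp: hom_def int_pow_distrib)
    then show ?thesis
      using hom_finprod_mem_subgroup[OF subgroup_H P _ finite_I, of "\<lambda>w. w [^] m" v]
        v v_pow K_subset by (auto simp: PiE_iff)
  qed
  obtain y where y: "y \<in> (\<Pi>\<^sub>E i\<in>I. K i)" "x = finprod G y I"
    using x(1) unfolding H_eq by blast
  have yH: "y i \<in> H" if "i \<in> I" for i using that y(1) K_subset by (auto simp: PiE_iff)
  have fy: "f (y i) \<in> power_image G (p ^ k)" if i: "i \<in> I" for i
  proof -
    have "height p G x = Min (insert Pinf ((\<lambda>i. height p G (y i)) ` I))"
      using val y by (simp add: valuated_direct_sum_def)
    then have "height p G x \<le> height p G (y i)"
      using i finite_I by simp
    then have "y i \<in> power_image G (p ^ k)"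
      using height_le_power_image x yH[OF i] subgroup.mem_carrier[OF subgroup_H] by blast
    moreover obtain m :: int where "y i = z i [^] m"
      using y(1) i K_eq[OF i] z_closed[OF i] by (auto simp: generate_pow PiE_iff)
    moreover have "z i \<in> H" using z_in_K[OF i] K_subset[OF i] by blast
    ultimately show ?thesis
      using cyclic[OF i] hom_subgroup_int_pow[OF subgroup_H fG] by simp
  qed
  show ?thesis
    using hom_finprod_mem_subgroup[OF subgroup_H P fG finite_I yH fy] y(2) by simp
qed

end

theorem theorem3p6:
  fixes G :: "('a, 'b) monoid_scheme" (structure)
    and p n :: nat
    and H :: "'a set"
    and K :: "nat \<Rightarrow> 'a set"
    and z :: "nat \<Rightarrow> 'a"
    and e :: "nat \<Rightarrow> nat"
  assumes "prime p"
    and "comm_group G"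
    and "p_group p G"
    and "finite H"
    and "internal_direct_sum G H {1..n} K"
    and "H \<inter> p_omega p G = {\<one>}"
    and "\<And>i. i \<in> {1..n} \<Longrightarrow> z i \<in> carrier G"
    and "\<And>i. i \<in> {1..n} \<Longrightarrow> K i = generate G {z i}"
    and "\<And>i. i \<in> {1..n} \<Longrightarrow> card (K i) = p ^ e i"
  shows "H \<in> \<W> G \<longleftrightarrow>
    (\<forall>i\<in>{1..n}. \<forall>j\<in>{1..n}. e j \<le> e i \<longrightarrow>
        ulm_sequence p G (z i) \<le> ulm_sequence p G (z j) \<and>
        ulm_sequence p G (z j) \<le> ulm_sequence p G (z i [^] (p ^ (e i - e j)))) \<and>
    valuated_direct_sum p G H {1..n} K"
    (is "_ \<longleftrightarrow> ?ulm \<and> ?val")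
proof -
  interpret abelian_p_group G p
    using assms(1-3) by (intro abelian_p_group.intro abelian_p_group_axioms.intro)
  interpret direct_sum_of_cyclics G p H "{1..n}" z K
    by unfold_locales (rule finite_atLeastAtMost assms(5,7,8) | assumption)+
  have ord: "ord (z i) = p ^ e i" if "i \<in> {1..n}" for i
    using generate_pow_card[OF assms(7)[OF that]] assms(8,9) that by simp
  have p1: "p > 1" by (rule prime_gt_1_nat[OF prime_p])
  have p_omega: "H \<inter> p_omega p G \<subseteq> {\<one>}" using assms(6) by simp
  show ?thesis
  proof
    assume W: "H \<in> \<W> G"
    have ?ulm
    proof (intro ballI impI conjI)
      fix i j assume i: "i \<in> {1..n}" and j: "j \<in> {1..n}" and le: "e j \<le> e i"
      have z: "z i \<in> H" "z j \<in> H" using z_in_K K_subset i j by blast+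
      have "z j [^] ord (z i) = \<one>"
        using z_closed[OF j] ord i j le by (simp add: pow_eq_id le_imp_power_dvd)
      then show "ulm_sequence p G (z i) \<le> ulm_sequence p G (z j)"
        by (rule ulm_sequence_le_if_extending[OF W i z(2)])
      show "ulm_sequence p G (z j) \<le> ulm_sequence p G (z i [^] (p ^ (e i - e j)))"
      proof (rule ulm_sequence_le_if_extending[OF W j])
        have "z i [^] int (p ^ (e i - e j)) \<in> H"
          by (rule subgroup_int_pow_closed[OF subgroup_H z(1)])
        then show "z i [^] (p ^ (e i - e j)) \<in> H" by (simp only: int_pow_int)
        have "(z i [^] (p ^ (e i - e j))) [^] ord (z j) = z i [^] ord (z i)"
          using z_closed[OF i] ord i j le by (simp add: nat_pow_pow flip: power_add)
        then show "(z i [^] (p ^ (e i - e j))) [^] ord (z j) = \<one>"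
          using z_closed[OF i] by simp
      qed
    qed
    moreover have ?val by (rule valuated_direct_sum_if_extending[OF W p_omega])
    ultimately show "?ulm \<and> ?val" ..
  next
    assume *: "?ulm \<and> ?val"
    obtain N where N: "H \<inter> power_image G (p ^ N) \<subseteq> {\<one>}"
      using bounded_heights[OF assms(4) p_omega] ..
    have ulm: "ulm_sequence p G (z i) \<le> ulm_sequence p G (z j) \<and>
        ulm_sequence p G (z j) \<le> ulm_sequence p G (z i [^] (ord (z i) div ord (z j)))"
      if i: "i \<in> {1..n}" and j: "j \<in> {1..n}" and le: "ord (z j) \<le> ord (z i)" for i j
    proof -
      have "e j \<le> e i" using le ord i j p1 by simp
      moreover from this have "ord (z i) div ord (z j) = p ^ (e i - e j)"
        using ord i j p1 by (simp add: power_diff)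
      ultimately show ?thesis using * i j by simp
    qed
    have val: ?val using * ..
    have "\<exists>g\<in>hom G G. \<forall>x\<in>H. g x = f x"
      if f: "f \<in> hom (G\<lparr>carrier := H\<rparr>) (G\<lparr>carrier := H\<rparr>)" for f
    proof (rule extend_height_increasing_hom[OF assms(1-3) comm_group_axioms subgroup_H N])
      show "f \<in> hom (G\<lparr>carrier := H\<rparr>) G"
        using f subgroup.mem_carrier[OF subgroup_H] by (auto simp: hom_def)
      show "f x \<in> power_image G (p ^ k)" if "x \<in> H" "x \<in> power_image G (p ^ k)" for k x
        by (rule hom_preserves_power_image[OF val ulm f that])
    qed
    then show "H \<in> \<W> G" using subgroup_H by (simp add: extending_subgroups_def)
  qed
qed

end
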